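(* Let $T\ge2$, $K\in\{0,\dots,T-2\}$, and $c(t)\ge0$ for $t=1,\dots,T$. Define $$A_T:=\frac18\sum_{t=1}^T(b-a+2c(t))^2+\sum_{t=2}^Tc(t)(b-a+2c(t-1)),\qquad C_T:=\sum_{t=1}^Tc(t),$$ and the binary entropy $H(x):=-x\log x-(1-x)\log(1-x)$ for $x\in[0,1]$, with $0\log0:=0$. Suppose the aggregation weights are generated by the Fixed Share algorithm with learning rate $\eta^*$ and mixing parameter $\alpha^*$ run on the cost-sensitive expert losses $\tilde\ell_j(t)$, where $(\eta^*,\alpha^* )$ is chosen as below. In each case the pair $(\eta^*,\alpha^* )$ is optimal, in the sense that it minimizes the upper bound $$U(\eta,\alpha):=\frac{\mathcal C(K,\alpha,n,T)}{\eta}+\eta A_T+2\alpha\left(1-\frac1n\right)C_T$$ over $\eta>0$, $\alpha\in[0,1)$, and the cost-sensitive tracking regret is bounded as stated. Case 1: $C_T=0$. With $\alpha^*=\frac K{T-1}\in[0,1)$ and $$\eta^*=\frac1{b-a}\sqrt{\frac8T\left((K+1)\log n+(T-1)H\left(\frac K{T-1}\right)\right)},$$ one has $$R^c_{\rm track}(T,K)\le(b-a)\sqrt{\frac T2\left((K+1)\log n+(T-1)H\left(\frac K{T-1}\right)\right)}.$$ Case 2: $C_T>0$ and $K=0$. With $\alpha^*=0$ and $\eta^*=\sqrt{\frac{\log n}{A_T}}$, one has $$R^c_{\rm track}(T,0)\le2\sqrt{A_T\log n}.$$ Case 3: $C_T>0$ and $K\ge1$. The equation $$\frac{K-(T-1)\alpha}{\alpha(1-\alpha)}=2\left(1-\frac1n\right)C_T\sqrt{\frac{\mathcal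 C(K,\alpha,n,T)}{A_T}}$$ has a unique solution $\alpha^*\in\left(0,\frac K{T-1}\right)$, and with this $\alpha^*$ and $\eta^*=\sqrt{\frac{\mathcal C(K,\alpha^*,n,T)}{A_T}}$, one has $$R^c_{\rm track}(T,K)\le2\sqrt{A_T\cdot\mathcal C(K,\alpha^*,n,T)}+2\left(1-\frac1n\right)\alpha^*C_T.$$
   Context: Let $m\ge2$ (number of assets), $\mathcal W:=\{\mathbf w\in\mathbb R_+^m:\mathbf w^\top\mathbf 1=1\}$, and $\mathcal Y\subseteq\mathbb R^m$. Let $\mathcal N$ be a finite set of $n\ge2$ experts. The loss $\ell:\mathcal W\times\mathcal Y\to\mathbb R$ is convex in its first argument and satisfies $a\le\ell(\mathbf w,\mathbf y)\le b$ for all $(\mathbf w,\mathbf y)$, where $a<b$ are fixed real constants. A prescribed initial portfolio $\mathbf w_0\in\mathcal W$ is given. Each expert $j\in\mathcal N$ provides portfolios $\mathbf w_j(t)\in\mathcal W$ for $t\ge1$, with $\mathbf w_j(0):=\mathbf w_0$; the outcomes are $\mathbf y(t)\in\mathcal Y$. The costs $c(t)$ are known over the whole horizon. The cost-sensitive loss of expert $j$ at time $t\ge1$ is $\tilde\ell_j(t):=\ell(\mathbf w_j(t),\mathbf y(t))+c(t)\|\mathbf w_j(t)-\mathbf w_j(t-1)\|_1$. Fixed Share with learning rate $\eta>0$ and mixing parameter $\alpha\in[0,1)$: $q_j(1)=1/n$ for all $j\in\mathcal N$, and for $t\ge1$, $$q_j^{\mathrm{exp}}(t)=\frac{q_j(t)e^{-\eta\tilde\ell_j(t)}}{\sum_{k\in\mathcal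 N}q_k(t)e^{-\eta\tilde\ell_k(t)}},\qquad q_j(t+1)=(1-\alpha)q_j^{\mathrm{exp}}(t)+\frac{\alpha}{n}.$$ The aggregate portfolio is $\widehat{\mathbf w}(t):=\sum_{j\in\mathcal N}q_j(t)\mathbf w_j(t)$ for $t\ge1$, with $\widehat{\mathbf w}(0):=\mathbf w_0$. For $\mathbf j=(j_1,\dots,j_T)\in\mathcal N^T$, let $S_T(\mathbf j):=\#\{t\in\{1,\dots,T-1\}:j_t\ne j_{t+1}\}$ and $\mathcal J_{T,K}:=\{\mathbf j\in\mathcal N^T:S_T(\mathbf j)\le K\}$. The cost-sensitive tracking regret is $$R^c_{\rm track}(T,K):=\sum_{t=1}^T\left[\ell(\widehat{\mathbf w}(t),\mathbf y(t))+c(t)\|\widehat{\mathbf w}(t)-\widehat{\mathbf w}(t-1)\|_1\right]-\min_{\mathbf j\in\mathcal J_{T,K}}\sum_{t=1}^T\tilde\ell_{j_t}(t).$$ The complexity term is $$\mathcal C(K,\alpha,n,T):=\begin{cases}\log n&\text{if }\alpha=0\text{ and }K=0,\\ \infty&\text{if }\alpha=0\text{ and }K>0,\\ (K+1)\log n+K\log\frac1\alpha+(T-K-1)\log\frac1{1-\alpha}&\text{otherwise.}\end{cases}$$ *)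

theory Defs
  imports "HOL-Analysis.Analysis"
begin

definition portfolios :: "(real^'m) set" where
  "portfolios = {w. (\<forall>i. 0 \<le> w $ i) \<and> (\<Sum>i\<in>UNIV. w $ i) = 1}"

definition l1_norm :: "real^'m \<Rightarrow> real" where
  "l1_norm x = (\<Sum>i\<in>UNIV. \<bar>x $ i\<bar>)"

(* Cost-sensitive loss at time t of a portfolio path p; only used for t \<ge> 1.  It is applied both
   to the path of an expert and to the aggregate path. *)
definition cost_loss ::
  "(real^'m \<Rightarrow> real^'m \<Rightarrow> real) \<Rightarrow> (nat \<Rightarrow> real^'m) \<Rightarrow> (nat \<Rightarrow> real) \<Rightarrow> (nat \<Rightarrow> real^'m) \<Rightarrow> nat \<Rightarrow> real"
  where "cost_loss l y c p t = l (p t) (y t) + c t * l1_norm (p t - p (t - 1))"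

definition exp_update ::
  "'e set \<Rightarrow> real \<Rightarrow> ('e \<Rightarrow> real) \<Rightarrow> ('e \<Rightarrow> real) \<Rightarrow> 'e \<Rightarrow> real"
  where "exp_update N \<eta> q L j =
    q j * exp (- \<eta> * L j) / (\<Sum>k\<in>N. q k * exp (- \<eta> * L k))"

(* Weights at time t for expert losses L j t.  Time starts at 1; the value at 0 is a dummy that is
   never used. *)
fun fixed_share ::
  "'e set \<Rightarrow> real \<Rightarrow> real \<Rightarrow> ('e \<Rightarrow> nat \<Rightarrow> real) \<Rightarrow> nat \<Rightarrow> 'e \<Rightarrow> real" where
  "fixed_share N \<eta> \<alpha> L 0 = (\<lambda>j. 1 / real (card N))"
| "fixed_share N \<eta> \<alpha> L (Suc 0) = (\<lambda>j. 1 / real (card N))"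
| "fixed_share N \<eta> \<alpha> L (Suc (Suc t)) = (\<lambda>j.
     (1 - \<alpha>) * exp_update N \<eta> (fixed_share N \<eta> \<alpha> L (Suc t)) (\<lambda>k. L k (Suc t)) j
     + \<alpha> / real (card N))"

definition aggregate ::
  "'e set \<Rightarrow> real^'m \<Rightarrow> ('e \<Rightarrow> nat \<Rightarrow> real^'m) \<Rightarrow> (nat \<Rightarrow> 'e \<Rightarrow> real) \<Rightarrow> nat \<Rightarrow> real^'m"
  where "aggregate N w0 w q t = (if t = 0 then w0 else (\<Sum>j\<in>N. q t j *\<^sub>R w j t))"

definition switches :: "nat \<Rightarrow> (nat \<Rightarrow> 'e) \<Rightarrow> nat" where
  "switches T js = card {t \<in> {1..T - 1}. js t \<noteq> js (t + 1)}"

definition comparators :: "'e set \<Rightarrow> nat \<Rightarrow> nat \<Rightarrow> (nat \<Rightarrow> 'e) set" where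
  "comparators N T K = {js \<in> {1..T} \<rightarrow>\<^sub>E N. switches T js \<le> K}"

definition tracking_regret ::
  "'e set \<Rightarrow> (real^'m \<Rightarrow> real^'m \<Rightarrow> real) \<Rightarrow> (nat \<Rightarrow> real^'m) \<Rightarrow> (nat \<Rightarrow> real) \<Rightarrow>
   real^'m \<Rightarrow> ('e \<Rightarrow> nat \<Rightarrow> real^'m) \<Rightarrow> (nat \<Rightarrow> 'e \<Rightarrow> real) \<Rightarrow> nat \<Rightarrow> nat \<Rightarrow> real"
  where "tracking_regret N l y c w0 w q T K =
    (\<Sum>t=1..T. cost_loss l y c (aggregate N w0 w q) t)
    - Min ((\<lambda>js. \<Sum>t=1..T. cost_loss l y c (w (js t)) t) ` comparators N T K)"

definition fixed_share_regret ::
  "'e set \<Rightarrow> (real^'m \<Rightarrow> real^'m \<Rightarrow> real) \<Rightarrow> (nat \<Rightarrow> real^'m) \<Rightarrow> (nat \<Rightarrow> real) \<Rightarrow>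
   real^'m \<Rightarrow> ('e \<Rightarrow> nat \<Rightarrow> real^'m) \<Rightarrow> real \<Rightarrow> real \<Rightarrow> nat \<Rightarrow> nat \<Rightarrow> real"
  where "fixed_share_regret N l y c w0 w \<eta> \<alpha> T K =
    tracking_regret N l y c w0 w
      (fixed_share N \<eta> \<alpha> (\<lambda>j. cost_loss l y c (w j))) T K"

definition complexity :: "nat \<Rightarrow> real \<Rightarrow> nat \<Rightarrow> nat \<Rightarrow> ereal" where
  "complexity K \<alpha> n T =
    (if \<alpha> = 0 \<and> K = 0 then ereal (ln (real n))
     else if \<alpha> = 0 \<and> K > 0 then \<infinity>
     else ereal ((real K + 1) * ln (real n) + real K * ln (1 / \<alpha>)
                 + (real T - real K - 1) * ln (1 / (1 - \<alpha>))))"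

definition A_term :: "real \<Rightarrow> real \<Rightarrow> (nat \<Rightarrow> real) \<Rightarrow> nat \<Rightarrow> real" where
  "A_term a b c T =
    1 / 8 * (\<Sum>t=1..T. (b - a + 2 * c t)\<^sup>2) + (\<Sum>t=2..T. c t * (b - a + 2 * c (t - 1)))"

definition total_cost :: "(nat \<Rightarrow> real) \<Rightarrow> nat \<Rightarrow> real" where
  "total_cost c T = (\<Sum>t=1..T. c t)"

(* The convention 0 log 0 = 0 holds automatically. *)
definition binary_entropy :: "real \<Rightarrow> real" where
  "binary_entropy x = - x * ln x - (1 - x) * ln (1 - x)"

definition upper_bound ::
  "real \<Rightarrow> real \<Rightarrow> (nat \<Rightarrow> real) \<Rightarrow> nat \<Rightarrow> nat \<Rightarrow> nat \<Rightarrow> real \<Rightarrow> real \<Rightarrow> ereal"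
  where "upper_bound a b c n T K \<eta> \<alpha> =
    complexity K \<alpha> n T / ereal \<eta> + ereal (\<eta> * A_term a b c T)
    + ereal (2 * \<alpha> * (1 - 1 / real n) * total_cost c T)"

definition optimal_parameters ::
  "real \<Rightarrow> real \<Rightarrow> (nat \<Rightarrow> real) \<Rightarrow> nat \<Rightarrow> nat \<Rightarrow> nat \<Rightarrow> real \<Rightarrow> real \<Rightarrow> bool"
  where "optimal_parameters a b c n T K \<eta> \<alpha> \<longleftrightarrow>
    is_arg_min (\<lambda>(\<eta>', \<alpha>'). upper_bound a b c n T K \<eta>' \<alpha>')
      (\<lambda>(\<eta>', \<alpha>'). \<eta>' > 0 \<and> \<alpha>' \<in> {0..<1}) (\<eta>, \<alpha>)"

(* The defining equation for the mixing parameter is only considered for 0 < \<alpha> < 1, where the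
   complexity is finite, so real_of_ereal loses nothing. *)
definition alpha_equation ::
  "real \<Rightarrow> real \<Rightarrow> (nat \<Rightarrow> real) \<Rightarrow> nat \<Rightarrow> nat \<Rightarrow> nat \<Rightarrow> real \<Rightarrow> bool"
  where "alpha_equation a b c n T K \<alpha> \<longleftrightarrow>
    (real K - (real T - 1) * \<alpha>) / (\<alpha> * (1 - \<alpha>)) =
    2 * (1 - 1 / real n) * total_cost c T
      * sqrt (real_of_ereal (complexity K \<alpha> n T) / A_term a b c T)"

end

theory Submission
  imports Defs "HOL-Probability.Hoeffding" "HOL-Real_Asymp.Real_Asymp"
begin

text \<open>
  The regret bound combines three estimates. First, Fixed Share is exact Bayesian averaging for a
  prior on paths of experts, so the product of its normalisers dominates the prior weight of any
  single path times the exponential of its loss. Taking logarithms bounds the summed mix loss by the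
  loss of the path plus the complexity divided by \<open>\<eta>\<close> (\<open>fixed_share_mix_loss\<close>). Secondly, in
  every round the average loss of the experts exceeds the mix loss by at most \<open>\<eta>\<close> times an eighth of
  the squared range of the losses (\<open>mix_loss_hoeffding\<close>); the range is \<open>b - a + 2 * c t\<close>, because
  portfolios are at distance at most two. Thirdly, by convexity the aggregate pays the average
  loss of the experts, except that its own transaction cost also includes the movement of
  the weights. One exponential update moves the weights by at most \<open>\<eta>\<close> times the range, by
  comparing the logarithmic with the arithmetic mean, and mixing with the uniform vector adds at most
  \<open>2 * \<alpha> * (1 - 1/n)\<close> (\<open>fixed_share_drift\<close>). Together these give the upper bound that is to be tuned
  (\<open>fixed_share_regret_le\<close>).

  For the tuning, let \<open>A\<close>, \<open>C \<alpha>\<close> and \<open>B * \<alpha>\<close> stand for \<open>A_term\<close>, the complexity and the term linear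
  in \<open>\<alpha>\<close>. The best rate is \<open>sqrt (C \<alpha> / A)\<close> and leaves \<open>2 * sqrt (A * C \<alpha>) + B * \<alpha>\<close>
  (\<open>optimal_parametersI\<close>). If \<open>B = 0\<close> or \<open>K = 0\<close>, it is enough to minimise \<open>C\<close>, and
  Gibbs' inequality gives the minimiser \<open>K / (T - 1)\<close>. Otherwise the derivative vanishes exactly at
  the solutions of \<open>alpha_equation\<close>. Left of \<open>K / (T - 1)\<close> the square root of \<open>C\<close> is strictly
  convex, because \<open>K < 2 * (K + 1) * ln n\<close>, its slope tends to minus infinity at \<open>0\<close> and vanishes at
  \<open>K / (T - 1)\<close>; so there is exactly one solution, and it is the minimiser on this side. Right of
  \<open>K / (T - 1)\<close> both summands are at least as large as at this point.
\<close>

section \<open>The norm of differences of portfolios\<close>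

lemma l1_norm_nonneg: "0 \<le> l1_norm x"
  by (simp add: l1_norm_def sum_nonneg)

lemma l1_norm_zero [simp]: "l1_norm 0 = 0"
  by (simp add: l1_norm_def)

lemma l1_norm_add: "l1_norm (x + y) \<le> l1_norm x + l1_norm y"
  by (simp add: l1_norm_def flip: sum.distrib) (intro sum_mono abs_triangle_ineq)

lemma l1_norm_scaleR: "l1_norm (r *\<^sub>R x) = \<bar>r\<bar> * l1_norm x"
  by (simp add: l1_norm_def abs_mult sum_distrib_left)

lemma l1_norm_sum: "l1_norm (\<Sum>i\<in>I. f i) \<le> (\<Sum>i\<in>I. l1_norm (f i))"
proof (induction I rule: infinite_finite_induct)
  case (insert i I)
  then show ?case
    using l1_norm_add[of "f i" "\<Sum>i\<in>I. f i"] by simp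
qed simp_all

lemma l1_norm_portfolio:
  assumes "u \<in> portfolios"
  shows "l1_norm u = 1"
proof -
  have "l1_norm u = (\<Sum>i\<in>UNIV. u $ i)"
    unfolding l1_norm_def using assms by (intro sum.cong) (auto simp: portfolios_def)
  then show ?thesis using assms by (simp add: portfolios_def)
qed

lemma l1_norm_portfolio_diff:
  assumes "u \<in> portfolios" "v \<in> portfolios"
  shows "l1_norm (u - v) \<le> 2"
  using l1_norm_add[of u "- 1 *\<^sub>R v"] l1_norm_scaleR[of "-1" v] assms
  by (simp add: l1_norm_portfolio)

section \<open>Exponential reweighting of a probability vector\<close>

definition weight_vector :: "'e set \<Rightarrow> ('e \<Rightarrow> real) \<Rightarrow> bool" where
  "weight_vector N q \<longleftrightarrow> (\<forall>j\<in>N. 0 \<le> q j) \<and> (\<Sum>j\<in>N. q j) = 1"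

lemma weight_vector_le_1:
  assumes "finite N" "weight_vector N q" "j \<in> N"
  shows "q j \<le> 1"
  using assms member_le_sum[of j N q] by (auto simp: weight_vector_def)

lemma mixture_pos:
  fixes f :: "'e \<Rightarrow> real"
  assumes "finite N" "weight_vector N q" "\<And>j. j \<in> N \<Longrightarrow> 0 < f j"
  shows "0 < (\<Sum>j\<in>N. q j * f j)"
proof -
  have "\<exists>j\<in>N. q j \<noteq> 0"
    using assms(2) sum.neutral[of N q] zero_neq_one unfolding weight_vector_def by metis
  then obtain j where "j \<in> N" "0 < q j"
    using assms(2) unfolding weight_vector_def by force
  then show ?thesis
    using assms by (intro sum_pos2[of N j]) (auto simp: weight_vector_def less_imp_le)
qed

lemma weight_vector_exp_update:
  assumes "finite N" "weight_vector N q"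
  shows "weight_vector N (exp_update N \<eta> q L)"
proof -
  have W: "0 < (\<Sum>k\<in>N. q k * exp (- \<eta> * L k))"
    using assms by (intro mixture_pos) auto
  show ?thesis
    using W assms(2) unfolding weight_vector_def exp_update_def
    by (auto simp flip: sum_divide_distrib intro!: divide_nonneg_pos)
qed

lemma tanh_le_self:
  fixes z :: real
  assumes "0 \<le> z"
  shows "tanh z \<le> z"
proof -
  have "0 - tanh 0 \<le> z - tanh z"
  proof (rule DERIV_nonneg_imp_nondecreasing[OF assms])
    fix x :: real
    have "((\<lambda>x. x - tanh x) has_real_derivative (tanh x)\<^sup>2) (at x)"
      by (auto intro!: derivative_eq_intros)
    then show "\<exists>d. ((\<lambda>x. x - tanh x) has_real_derivative d) (at x) \<and> 0 \<le> d"
      by (intro exI[of _ "(tanh x)\<^sup>2"]) auto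
  qed
  then show ?thesis by simp
qed

text \<open>
  The logarithmic mean of \<open>exp x\<close> and \<open>exp y\<close> is at most their arithmetic mean; with \<open>z\<close> half the
  distance of \<open>x\<close> and \<open>y\<close> this is \<open>tanh z \<le> z\<close>.
\<close>

lemma abs_exp_diff_le:
  fixes x y :: real
  shows "\<bar>exp x - exp y\<bar> \<le> (exp x + exp y) / 2 * \<bar>x - y\<bar>"
proof (induction x y rule: linorder_wlog)
  case (le x y)
  define z where "z = (y - x) / 2"
  have z: "0 \<le> z" "y = x + 2 * z" using le by (auto simp: z_def field_simps)
  have "tanh z * (1 + exp (- 2 * z)) = 1 - exp (- 2 * z)"
    by (simp add: tanh_real_altdef add_nonneg_eq_0_iff)
  then have "exp y * (tanh z * (1 + exp (- 2 * z))) = exp y * (1 - exp (- 2 * z))"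
    by simp
  moreover have "exp y * exp (- 2 * z) = exp x"
    using z by (simp flip: exp_add)
  moreover have "exp y * (tanh z * (1 + exp (- 2 * z))) = tanh z * (exp y + exp y * exp (- 2 * z))"
    and "exp y * (1 - exp (- 2 * z)) = exp y - exp y * exp (- 2 * z)"
    by (simp_all only: ring_distribs mult_ac mult_1_right)
  ultimately have eq: "tanh z * (exp x + exp y) = exp y - exp x"
    by (simp only: add.commute)
  have "tanh z * (exp x + exp y) \<le> z * (exp x + exp y)"
    using tanh_le_self[OF z(1)] by (intro mult_right_mono) auto
  then show ?case using eq z by (simp add: algebra_simps)
next
  case (sym x y)
  then show ?case by (simp add: abs_minus_commute add.commute)
qed

text \<open>
  With \<open>u j = exp (- \<eta> * L j)\<close> and \<open>W\<close> the mean of \<open>u\<close> under \<open>q\<close>, the update moves the weight of \<open>j\<close> by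
  \<open>q j * (u j - W) / W\<close>. Averaging \<open>u j - u k\<close> over \<open>k\<close> reduces this to pairs, where the two-sided
  factor \<open>(u j + u k) / 2\<close> averages to exactly \<open>W\<close> and cancels the normalisation.
\<close>

lemma exp_update_l1_le:
  assumes N: "finite N" and q: "weight_vector N q" and "0 \<le> \<eta>"
    and D: "\<And>j k. j \<in> N \<Longrightarrow> k \<in> N \<Longrightarrow> \<bar>L j - L k\<bar> \<le> D"
  shows "(\<Sum>j\<in>N. \<bar>exp_update N \<eta> q L j - q j\<bar>) \<le> \<eta> * D"
proof -
  define u where "u j = exp (- \<eta> * L j)" for j
  define W where "W = (\<Sum>k\<in>N. q k * u k)"
  have q0: "0 \<le> q j" if "j \<in> N" for j using q that by (auto simp: weight_vector_def)
  have q1: "(\<Sum>k\<in>N. q k) = 1" using q by (simp add: weight_vector_def)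
  have W: "0 < W" unfolding W_def u_def using N q by (intro mixture_pos) auto
  have pair: "\<bar>u j - u k\<bar> \<le> (u j + u k) / 2 * (\<eta> * D)" if "j \<in> N" "k \<in> N" for j k
  proof -
    have "\<bar>- \<eta> * L j - - \<eta> * L k\<bar> = \<eta> * \<bar>L j - L k\<bar>"
      using \<open>0 \<le> \<eta>\<close> abs_mult[of "- \<eta>" "L j - L k"] by (simp add: right_diff_distrib)
    also have "\<dots> \<le> \<eta> * D" using D[OF that] \<open>0 \<le> \<eta>\<close> by (intro mult_left_mono)
    finally have "(u j + u k) / 2 * \<bar>- \<eta> * L j - - \<eta> * L k\<bar> \<le> (u j + u k) / 2 * (\<eta> * D)"
      by (intro mult_left_mono) (auto simp: u_def)
    then show ?thesis
      using abs_exp_diff_le[of "- \<eta> * L j" "- \<eta> * L k"] unfolding u_def by linarith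
  qed
  have "W * (\<Sum>j\<in>N. \<bar>exp_update N \<eta> q L j - q j\<bar>) = (\<Sum>j\<in>N. q j * \<bar>u j - W\<bar>)"
    unfolding sum_distrib_left
  proof (intro sum.cong refl)
    fix j assume j: "j \<in> N"
    have "W * \<bar>exp_update N \<eta> q L j - q j\<bar> = \<bar>W * (q j * u j / W - q j)\<bar>"
      using W by (simp add: abs_mult exp_update_def u_def W_def)
    also have "W * (q j * u j / W - q j) = q j * (u j - W)"
      using W by (simp add: field_simps)
    also have "\<bar>q j * (u j - W)\<bar> = q j * \<bar>u j - W\<bar>"
      using q0[OF j] by (simp add: abs_mult)
    finally show "W * \<bar>exp_update N \<eta> q L j - q j\<bar> = q j * \<bar>u j - W\<bar>" .
  qed
  also have "\<dots> \<le> (\<Sum>j\<in>N. q j * (\<Sum>k\<in>N. q k * ((u j + u k) / 2 * (\<eta> * D))))"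
  proof (intro sum_mono mult_left_mono q0)
    fix j assume j: "j \<in> N"
    have "u j - W = (\<Sum>k\<in>N. q k * (u j - u k))"
      by (simp add: W_def right_diff_distrib sum_subtractf q1 flip: sum_distrib_right)
    also have "\<bar>\<dots>\<bar> \<le> (\<Sum>k\<in>N. \<bar>q k * (u j - u k)\<bar>)" by (rule sum_abs)
    also have "\<dots> \<le> (\<Sum>k\<in>N. q k * ((u j + u k) / 2 * (\<eta> * D)))"
    proof (rule sum_mono)
      fix k assume k: "k \<in> N"
      have "\<bar>q k * (u j - u k)\<bar> = q k * \<bar>u j - u k\<bar>"
        using q0[OF k] by (simp add: abs_mult)
      then show "\<bar>q k * (u j - u k)\<bar> \<le> q k * ((u j + u k) / 2 * (\<eta> * D))"
        using mult_left_mono[OF pair[OF j k] q0[OF k]] by simp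
    qed
    finally show "\<bar>u j - W\<bar> \<le> (\<Sum>k\<in>N. q k * ((u j + u k) / 2 * (\<eta> * D)))" .
  qed
  also have "\<dots> = (\<Sum>j\<in>N. \<Sum>k\<in>N. (q j * u j) * q k * (\<eta> * D / 2) + q j * (q k * u k) * (\<eta> * D / 2))"
    by (simp add: sum_distrib_left algebra_simps add_divide_distrib)
  also have "\<dots> = (\<Sum>j\<in>N. q j * u j * (\<eta> * D / 2) + q j * W * (\<eta> * D / 2))"
  proof (intro sum.cong refl)
    fix j
    have "(\<Sum>k\<in>N. (q j * u j) * q k * (\<eta> * D / 2)) = q j * u j * (\<eta> * D / 2)"
      by (simp only: q1 mult_1_right flip: sum_distrib_left sum_distrib_right)
    moreover have "(\<Sum>k\<in>N. q j * (q k * u k) * (\<eta> * D / 2)) = q j * W * (\<eta> * D / 2)"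
      unfolding W_def by (simp only: sum_distrib_left sum_distrib_right)
    ultimately show "(\<Sum>k\<in>N. (q j * u j) * q k * (\<eta> * D / 2) + q j * (q k * u k) * (\<eta> * D / 2))
        = q j * u j * (\<eta> * D / 2) + q j * W * (\<eta> * D / 2)"
      by (simp only: sum.distrib)
  qed
  also have "\<dots> = W * (\<eta> * D)"
    by (simp only: sum.distrib q1 flip: W_def sum_distrib_right)
  finally show ?thesis using W by simp
qed

text \<open>
  Hoeffding's lemma for the random variable \<open>- L\<close> on the expert set, distributed according to \<open>q\<close>.
\<close>

lemma mix_loss_hoeffding:
  assumes N: "finite N" and q: "weight_vector N q" and "0 < \<eta>"
    and L: "\<And>j. j \<in> N \<Longrightarrow> lo \<le> L j \<and> L j \<le> hi"
  shows "(\<Sum>j\<in>N. q j * L j) \<le> - ln (\<Sum>j\<in>N. q j * exp (- \<eta> * L j)) / \<eta> + \<eta> * (hi - lo)\<^sup>2 / 8"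
proof -
  define M where "M = point_measure N (\<lambda>j. ennreal (q j))"
  define \<mu> where "\<mu> = (\<Sum>j\<in>N. q j * L j)"
  define W where "W = (\<Sum>j\<in>N. q j * exp (- \<eta> * L j))"
  have q0: "0 \<le> q j" if "j \<in> N" for j using q that by (auto simp: weight_vector_def)
  have q1: "(\<Sum>k\<in>N. q k) = 1" using q by (simp add: weight_vector_def)
  have W: "0 < W" unfolding W_def using N q by (intro mixture_pos) auto
  have int: "(\<integral>x. g x \<partial>M) = (\<Sum>j\<in>N. q j * g j)" for g :: "'a \<Rightarrow> real"
    unfolding M_def using N q0 by (simp add: lebesgue_integral_point_measure_finite)
  have M_sets: "sets M = Pow N" "space M = N"
    by (simp_all add: M_def sets_point_measure space_point_measure)
  interpret prob_space M
  proof
    have "emeasure M (space M) = (\<Sum>j\<in>N. ennreal (q j))"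
      unfolding M_def using N by (simp add: emeasure_point_measure_finite space_point_measure)
    also have "\<dots> = 1" using q0 q1 by (simp add: sum_ennreal)
    finally show "emeasure M (space M) = 1" .
  qed
  interpret interval_bounded_random_variable M "\<lambda>j. - L j" "- hi" "- lo"
  proof unfold_locales
    show "random_variable borel (\<lambda>j. - L j)"
      by (simp add: measurable_def M_sets)
    show "AE x in M. - L x \<in> {- hi..- lo}"
      using L by (intro AE_I2) (auto simp: M_sets)
  qed
  have "nn_integral M (\<lambda>x. exp (\<eta> * (- L x - expectation (\<lambda>j. - L j)))) 
      \<le> ennreal (exp (\<eta>\<^sup>2 * (- lo - - hi)\<^sup>2 / 8))"
    using Hoeffdings_lemma_nn_integral[OF \<open>0 < \<eta>\<close>] by simp
  moreover have "expectation (\<lambda>j. - L j) = - \<mu>"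
    unfolding int \<mu>_def by (simp add: sum_negf)
  moreover have "nn_integral M (\<lambda>x. exp (\<eta> * (- L x + \<mu>))) = ennreal (exp (\<eta> * \<mu>) * W)"
  proof -
    have "nn_integral M (\<lambda>x. exp (\<eta> * (- L x + \<mu>)))
        = (\<Sum>j\<in>N. ennreal (q j) * ennreal (exp (\<eta> * (- L j + \<mu>))))"
      unfolding M_def using N by (rule nn_integral_point_measure_finite)
    also have "\<dots> = ennreal (\<Sum>j\<in>N. q j * exp (\<eta> * (- L j + \<mu>)))"
      using q0 by (simp add: sum_nonneg flip: ennreal_mult sum_ennreal)
    also have "(\<Sum>j\<in>N. q j * exp (\<eta> * (- L j + \<mu>))) = exp (\<eta> * \<mu>) * W"
      by (simp add: W_def sum_distrib_left right_diff_distrib exp_diff exp_minus field_simps)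
    finally show ?thesis .
  qed
  ultimately have "exp (\<eta> * \<mu>) * W \<le> exp (\<eta>\<^sup>2 * (hi - lo)\<^sup>2 / 8)"
    by (simp add: algebra_simps)
  then have "ln (exp (\<eta> * \<mu>) * W) \<le> \<eta>\<^sup>2 * (hi - lo)\<^sup>2 / 8"
    using W ln_le_cancel_iff[of "exp (\<eta> * \<mu>) * W" "exp (\<eta>\<^sup>2 * (hi - lo)\<^sup>2 / 8)"] by simp
  then have "\<eta> * \<mu> \<le> - ln W + \<eta>\<^sup>2 * (hi - lo)\<^sup>2 / 8"
    using W by (simp add: ln_mult)
  then have "\<mu> \<le> (- ln W + \<eta>\<^sup>2 * (hi - lo)\<^sup>2 / 8) / \<eta>"
    using \<open>0 < \<eta>\<close> by (simp add: pos_le_divide_eq mult.commute)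
  also have "\<dots> = - ln W / \<eta> + \<eta> * (hi - lo)\<^sup>2 / 8"
    using \<open>0 < \<eta>\<close> by (simp add: field_simps power2_eq_square)
  finally show ?thesis by (simp add: \<mu>_def W_def)
qed

section \<open>Fixed Share weights and their movement\<close>

lemma weight_vector_fixed_share:
  assumes "finite N" "N \<noteq> {}" "0 \<le> \<alpha>" "\<alpha> \<le> 1"
  shows "weight_vector N (fixed_share N \<eta> \<alpha> L t)"
proof (induction t)
  case 0
  then show ?case using assms by (simp add: weight_vector_def)
next
  case (Suc t)
  show ?case
  proof (cases t)
    case 0
    then show ?thesis using assms by (simp add: weight_vector_def)
  next
    case t: (Suc s)
    define u where "u = exp_update N \<eta> (fixed_share N \<eta> \<alpha> L t) (\<lambda>k. L k t)"
    have u: "weight_vector N u"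
      unfolding u_def using assms(1) Suc by (intro weight_vector_exp_update)
    have eq: "fixed_share N \<eta> \<alpha> L (Suc t) = (\<lambda>j. (1 - \<alpha>) * u j + \<alpha> / real (card N))"
      by (simp add: t u_def)
    have "(\<Sum>j\<in>N. (1 - \<alpha>) * u j + \<alpha> / real (card N))
        = (1 - \<alpha>) * (\<Sum>j\<in>N. u j) + \<alpha>"
      using assms by (simp add: sum.distrib sum_distrib_left)
    then show ?thesis
      using u assms unfolding eq by (auto simp: weight_vector_def)
  qed
qed

text \<open>
  On \<open>[0, 1]\<close> the convex function \<open>x \<mapsto> \<bar>1/n - x\<bar>\<close> lies below its chord, and the sum of the chords
  depends only on the total weight.
\<close>

lemma uniform_weight_l1_le:
  assumes N: "finite N" "card N = n" "0 < n" and q: "weight_vector N q"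
  shows "(\<Sum>j\<in>N. \<bar>1 / real n - q j\<bar>) \<le> 2 * (1 - 1 / real n)"
proof -
  have "\<bar>1 / real n - q j\<bar> \<le> q j * (1 - 1 / real n) + (1 - q j) * (1 / real n)" if "j \<in> N" for j
  proof -
    have q: "0 \<le> q j" "q j \<le> 1"
      using q weight_vector_le_1[OF N(1) q that] that by (auto simp: weight_vector_def)
    define r where "r = 1 / real n"
    have r: "0 \<le> r" "r \<le> 1" using N by (auto simp: r_def)
    have "0 \<le> q j * (1 - r)" "0 \<le> (1 - q j) * r" using q r by auto
    then have "\<bar>r - q j\<bar> \<le> q j * (1 - r) + (1 - q j) * r"
      by (auto simp: algebra_simps abs_le_iff)
    then show ?thesis by (simp add: r_def)
  qed
  then have "(\<Sum>j\<in>N. \<bar>1 / real n - q j\<bar>)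
      \<le> (\<Sum>j\<in>N. q j * (1 - 1 / real n) + (1 - q j) * (1 / real n))"
    by (intro sum_mono)
  also have "\<dots> = (\<Sum>j\<in>N. q j) * (1 - 1 / real n) + (real n - (\<Sum>j\<in>N. q j)) * (1 / real n)"
    using N by (simp only: sum.distrib sum_subtractf flip: sum_distrib_right) simp
  also have "\<dots> = 2 * (1 - 1 / real n)"
    using q N by (simp add: weight_vector_def field_simps)
  finally show ?thesis .
qed

text \<open>
  One round moves the weights by a convex combination of the exponential update and the pull towards
  the uniform vector. The aggregate pays for this movement on top of the average
  transaction cost of the experts.
\<close>

lemma fixed_share_drift:
  assumes N: "finite N" "card N = n" "0 < n" and "0 \<le> \<eta>" "0 \<le> \<alpha>" "\<alpha> \<le> 1" and t: "1 \<le> t"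
    and D: "\<And>j k. j \<in> N \<Longrightarrow> k \<in> N \<Longrightarrow> \<bar>L j t - L k t\<bar> \<le> D"
  shows "(\<Sum>j\<in>N. \<bar>fixed_share N \<eta> \<alpha> L (Suc t) j - fixed_share N \<eta> \<alpha> L t j\<bar>)
    \<le> \<eta> * D + 2 * \<alpha> * (1 - 1 / real n)"
proof -
  define q where "q = fixed_share N \<eta> \<alpha> L t"
  define u where "u = exp_update N \<eta> q (\<lambda>k. L k t)"
  have "N \<noteq> {}" using N by auto
  then have q: "weight_vector N q"
    unfolding q_def using assms by (intro weight_vector_fixed_share) auto
  have "0 \<le> D" using D \<open>N \<noteq> {}\<close> by fastforce
  obtain s where s: "t = Suc s" using t by (cases t) auto
  have step: "fixed_share N \<eta> \<alpha> L (Suc t) j - q j = (1 - \<alpha>) * (u j - q j) + \<alpha> * (1 / real n - q j)" for j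
    using N by (simp add: s u_def q_def algebra_simps)
  have "(\<Sum>j\<in>N. \<bar>fixed_share N \<eta> \<alpha> L (Suc t) j - q j\<bar>)
      \<le> (\<Sum>j\<in>N. (1 - \<alpha>) * \<bar>u j - q j\<bar> + \<alpha> * \<bar>1 / real n - q j\<bar>)"
    unfolding step using assms
    by (intro sum_mono order_trans[OF abs_triangle_ineq]) (simp add: abs_mult)
  also have "\<dots> = (1 - \<alpha>) * (\<Sum>j\<in>N. \<bar>u j - q j\<bar>) + \<alpha> * (\<Sum>j\<in>N. \<bar>1 / real n - q j\<bar>)"
    by (simp add: sum.distrib sum_distrib_left)
  also have "\<dots> \<le> (1 - \<alpha>) * (\<eta> * D) + \<alpha> * (2 * (1 - 1 / real n))"
    using assms q unfolding u_def
    by (intro add_mono mult_left_mono exp_update_l1_le uniform_weight_l1_le) auto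
  also have "\<dots> \<le> \<eta> * D + 2 * \<alpha> * (1 - 1 / real n)"
    using mult_left_le[of "1 - \<alpha>" "\<eta> * D"] assms \<open>0 \<le> D\<close> by (simp add: mult_ac)
  finally show ?thesis by (simp add: q_def)
qed

section \<open>The mix loss against a switching comparator\<close>

text \<open>
  Up to normalisation, the cross entropy of the Bernoulli distribution with parameter \<open>k / (k + m)\<close>
  relative to the one with parameter \<open>x\<close>, shifted by \<open>c\<^sub>0\<close>. With \<open>c\<^sub>0 = (K + 1) ln n\<close>, \<open>k = K\<close> and
  \<open>m = T - K - 1\<close> it is the finite part of the complexity term. The parameters are real so that the
  calculus below does not depend on where they come from.
\<close>

definition cross_cost :: "real \<Rightarrow> real \<Rightarrow> real \<Rightarrow> real \<Rightarrow> real" where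
  "cross_cost c\<^sub>0 k m x = c\<^sub>0 + k * ln (1 / x) + m * ln (1 / (1 - x))"

text \<open>
  The weight that Fixed Share puts on the end point of a path, times the normalisers removed so far,
  dominates the weight of that single path under the Markov chain prior that keeps an expert with
  probability \<open>1 - \<alpha> + \<alpha> / n\<close> and jumps to a given other one with probability \<open>\<alpha> / n\<close>.
\<close>

lemma fixed_share_path_weight:
  assumes N: "finite N" "card N = n" "0 < n" and "0 \<le> \<alpha>" "\<alpha> \<le> 1"
    and js: "\<And>t. t \<in> {1..Suc T} \<Longrightarrow> js t \<in> N"
  shows "1 / real n * (\<Prod>t=1..T. if js t = js (t + 1) then 1 - \<alpha> + \<alpha> / real n else \<alpha> / real n)
      * exp (- \<eta> * (\<Sum>t=1..T. L (js t) t))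
    \<le> fixed_share N \<eta> \<alpha> L (Suc T) (js (Suc T))
      * (\<Prod>t=1..T. \<Sum>j\<in>N. fixed_share N \<eta> \<alpha> L t j * exp (- \<eta> * L j t))"
  using js
proof (induction T)
  case 0
  then show ?case using N by simp
next
  case (Suc T)
  define q where "q = fixed_share N \<eta> \<alpha> L (Suc T)"
  define W where "W = (\<lambda>t. \<Sum>j\<in>N. fixed_share N \<eta> \<alpha> L t j * exp (- \<eta> * L j t))"
  define \<rho> where "\<rho> = (\<lambda>t. if js t = js (t + 1) then 1 - \<alpha> + \<alpha> / real n else \<alpha> / real n)"
  define i where "i = js (Suc T)"
  define k where "k = js (Suc (Suc T))"
  define u where "u = exp_update N \<eta> q (\<lambda>k. L k (Suc T))"
  have "N \<noteq> {}" using N by auto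
  have q: "weight_vector N (fixed_share N \<eta> \<alpha> L t)" for t
    using assms \<open>N \<noteq> {}\<close> by (intro weight_vector_fixed_share) auto
  have W: "0 < W t" for t unfolding W_def using N q by (intro mixture_pos) auto
  have i: "i \<in> N" and k: "k \<in> N" using Suc.prems by (auto simp: i_def k_def)
  have u: "weight_vector N u"
    unfolding u_def q_def using N q by (intro weight_vector_exp_update)
  have u01: "0 \<le> u j" "u j \<le> 1" if "j \<in> N" for j
    using u weight_vector_le_1[OF N(1) u that] that by (auto simp: weight_vector_def)
  have "0 \<le> \<alpha> / real n" using assms by simp
  have "\<rho> (Suc T) * u i \<le> (1 - \<alpha>) * u k + \<alpha> / real n"
  proof (cases "i = k")
    case True
    have "\<alpha> / real n * u i \<le> \<alpha> / real n"
      using \<open>0 \<le> \<alpha> / real n\<close> u01[OF i] by (intro mult_left_le)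
    then show ?thesis using True by (simp add: \<rho>_def i_def k_def distrib_right)
  next
    case False
    have "\<alpha> / real n * u i \<le> \<alpha> / real n"
      using \<open>0 \<le> \<alpha> / real n\<close> u01[OF i] by (intro mult_left_le)
    moreover have "0 \<le> (1 - \<alpha>) * u k" using u01[OF k] assms by simp
    ultimately show ?thesis using False by (simp add: \<rho>_def i_def k_def)
  qed
  also have "\<dots> = fixed_share N \<eta> \<alpha> L (Suc (Suc T)) k"
    using N by (simp add: u_def q_def)
  finally have "\<rho> (Suc T) * u i * W (Suc T) \<le> fixed_share N \<eta> \<alpha> L (Suc (Suc T)) k * W (Suc T)"
    using W[of "Suc T"] by (intro mult_right_mono) auto
  moreover have "u i * W (Suc T) = q i * exp (- \<eta> * L i (Suc T))"
    using W[of "Suc T"] by (simp add: u_def exp_update_def q_def W_def)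
  ultimately have step: "\<rho> (Suc T) * (q i * exp (- \<eta> * L i (Suc T)))
      \<le> fixed_share N \<eta> \<alpha> L (Suc (Suc T)) k * W (Suc T)"
    by (simp add: mult.assoc)
  have \<rho>0: "0 \<le> \<rho> t" for t using assms by (auto simp: \<rho>_def)
  have IH: "1 / real n * (\<Prod>t=1..T. \<rho> t) * exp (- \<eta> * (\<Sum>t=1..T. L (js t) t)) \<le> q i * (\<Prod>t=1..T. W t)"
    using Suc.IH Suc.prems unfolding \<rho>_def W_def q_def i_def by auto
  have "1 / real n * (\<Prod>t=1..Suc T. \<rho> t) * exp (- \<eta> * (\<Sum>t=1..Suc T. L (js t) t))
      = (1 / real n * (\<Prod>t=1..T. \<rho> t) * exp (- \<eta> * (\<Sum>t=1..T. L (js t) t)))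
        * (\<rho> (Suc T) * exp (- \<eta> * L i (Suc T)))"
    by (simp add: i_def exp_add exp_diff distrib_left right_diff_distrib exp_minus field_simps)
  also have "\<dots> \<le> q i * (\<Prod>t=1..T. W t) * (\<rho> (Suc T) * exp (- \<eta> * L i (Suc T)))"
    using IH \<rho>0 by (intro mult_right_mono) auto
  also have "\<dots> = (\<rho> (Suc T) * (q i * exp (- \<eta> * L i (Suc T)))) * (\<Prod>t=1..T. W t)"
    by (simp add: mult_ac)
  also have "\<dots> \<le> fixed_share N \<eta> \<alpha> L (Suc (Suc T)) k * W (Suc T) * (\<Prod>t=1..T. W t)"
    using W by (intro mult_right_mono[OF step] prod_nonneg) (auto simp: less_imp_le)
  also have "\<dots> = fixed_share N \<eta> \<alpha> L (Suc (Suc T)) k * (\<Prod>t=1..Suc T. W t)"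
    by (simp add: mult_ac)
  finally show ?case unfolding \<rho>_def W_def k_def .
qed

text \<open>
  The prior weight of the comparator path is at least that of a path with exactly \<open>K\<close> switches. This
  needs the full probability \<open>1 - \<alpha> + \<alpha> / n\<close> of staying, since \<open>1 - \<alpha>\<close> alone may be smaller than
  the probability \<open>\<alpha> / n\<close> of a jump, and then paths with fewer switches would get a worse bound. Only
  after trading \<open>K - S\<close> stays for jumps is the extra \<open>\<alpha> / n\<close> dropped.
\<close>

lemma fixed_share_mix_loss:
  assumes N: "finite N" "card N = n" "0 < n" and "0 < \<eta>" "0 \<le> \<alpha>" "\<alpha> < 1" and \<alpha>: "0 < \<alpha> \<or> K = 0"
    and T: "1 \<le> T" "K < T" and js: "js \<in> comparators N T K"
  shows "(\<Sum>t=1..T. - ln (\<Sum>j\<in>N. fixed_share N \<eta> \<alpha> L t j * exp (- \<eta> * L j t)) / \<eta>)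
    \<le> (\<Sum>t=1..T. L (js t) t)
      + cross_cost ((real K + 1) * ln (real n)) (real K) (real T - real K - 1) \<alpha> / \<eta>"
proof -
  define W where "W = (\<lambda>t. \<Sum>j\<in>N. fixed_share N \<eta> \<alpha> L t j * exp (- \<eta> * L j t))"
  define \<rho> where "\<rho> = (\<lambda>t. if js t = js (t + 1) then 1 - \<alpha> + \<alpha> / real n else \<alpha> / real n)"
  define S where "S = switches T js"
  define r where "r = \<alpha> / real n"
  obtain T' where T': "T = Suc T'" using T by (cases T) auto
  have jsN: "js t \<in> N" if "t \<in> {1..T}" for t
    using js that by (auto simp: comparators_def)
  have SK: "S \<le> K" using js by (simp add: comparators_def S_def)
  have "N \<noteq> {}" using N by auto
  have q: "weight_vector N (fixed_share N \<eta> \<alpha> L t)" for t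
    using assms \<open>N \<noteq> {}\<close> by (intro weight_vector_fixed_share) auto
  have W: "0 < W t" for t unfolding W_def using N q by (intro mixture_pos) auto
  have r: "0 \<le> r" using assms by (simp add: r_def)
  have "(1 - \<alpha>) ^ (T' - K) * r ^ K \<le> (1 - \<alpha> + r) ^ (T' - K) * ((1 - \<alpha> + r) ^ (K - S) * r ^ S)"
  proof (intro mult_mono power_mono)
    have "r ^ K = r ^ (K - S) * r ^ S" using SK by (simp flip: power_add)
    also have "\<dots> \<le> (1 - \<alpha> + r) ^ (K - S) * r ^ S"
      using r assms by (intro mult_right_mono power_mono) auto
    finally show "r ^ K \<le> (1 - \<alpha> + r) ^ (K - S) * r ^ S" .
  qed (use r assms in auto)
  also have "\<dots> = (1 - \<alpha> + r) ^ (T' - S) * r ^ S"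
    using SK T T' by (simp flip: power_add mult.assoc)
  also have "\<dots> = (\<Prod>t=1..T'. \<rho> t)"
  proof -
    define A where "A = {t \<in> {1..T'}. js t \<noteq> js (t + 1)}"
    have S: "card A = S" by (simp add: A_def S_def switches_def T')
    have A: "A \<subseteq> {1..T'}" "{1..T'} \<inter> {t. js t = js (t + 1)} = {1..T'} - A"
      "{1..T'} \<inter> - {t. js t = js (t + 1)} = A"
      by (auto simp: A_def)
    have "card ({1..T'} - A) = T' - S"
      using A(1) S by (subst card_Diff_subset) (auto intro: finite_subset)
    then show ?thesis
      unfolding \<rho>_def r_def by (simp add: prod.If_cases A[simplified] S)
  qed
  finally have \<rho>: "(1 - \<alpha>) ^ (T' - K) * r ^ K \<le> (\<Prod>t=1..T'. \<rho> t)" .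
  have "1 / real n * ((1 - \<alpha>) ^ (T' - K) * r ^ K) * exp (- \<eta> * (\<Sum>t=1..T. L (js t) t))
    \<le> (1 / real n * (\<Prod>t=1..T'. \<rho> t) * exp (- \<eta> * (\<Sum>t=1..T'. L (js t) t))) * exp (- \<eta> * L (js T) T)"
  proof -
    have "exp (- \<eta> * (\<Sum>t=1..T. L (js t) t))
        = exp (- \<eta> * (\<Sum>t=1..T'. L (js t) t)) * exp (- \<eta> * L (js T) T)"
      by (simp add: T' distrib_left flip: exp_add)
    moreover have "1 / real n * ((1 - \<alpha>) ^ (T' - K) * r ^ K) * e * f
        \<le> 1 / real n * (\<Prod>t=1..T'. \<rho> t) * e * f" if "0 < e" "0 < f" for e f :: real
      using that by (intro mult_right_mono mult_left_mono[OF \<rho>]) auto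
    ultimately show ?thesis by (simp only: mult.assoc[symmetric] exp_gt_zero)
  qed
  also have "\<dots> \<le> (fixed_share N \<eta> \<alpha> L T (js T) * (\<Prod>t=1..T'. W t)) * exp (- \<eta> * L (js T) T)"
    unfolding \<rho>_def W_def T' using assms jsN unfolding T'
    by (intro mult_right_mono fixed_share_path_weight) auto
  also have "\<dots> = (fixed_share N \<eta> \<alpha> L T (js T) * exp (- \<eta> * L (js T) T)) * (\<Prod>t=1..T'. W t)"
    by (simp add: mult_ac)
  also have "\<dots> \<le> W T * (\<Prod>t=1..T'. W t)"
  proof (intro mult_right_mono prod_nonneg)
    show "fixed_share N \<eta> \<alpha> L T (js T) * exp (- \<eta> * L (js T) T) \<le> W T"
      unfolding W_def using q[of T] jsN[of T] T N(1)
      by (intro member_le_sum[of "js T" N "\<lambda>j. fixed_share N \<eta> \<alpha> L T j * exp (- \<eta> * L j T)"])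
        (auto simp: weight_vector_def)
  qed (use W in \<open>auto simp: less_imp_le\<close>)
  also have "\<dots> = (\<Prod>t=1..T. W t)" by (simp add: T' mult_ac)
  finally have "1 / real n * ((1 - \<alpha>) ^ (T' - K) * r ^ K) * exp (- \<eta> * (\<Sum>t=1..T. L (js t) t))
    \<le> (\<Prod>t=1..T. W t)" .
  moreover have rK: "0 < r ^ K" using \<alpha> N by (auto simp: r_def)
  ultimately have "ln (1 / real n * ((1 - \<alpha>) ^ (T' - K) * r ^ K) * exp (- \<eta> * (\<Sum>t=1..T. L (js t) t)))
    \<le> ln (\<Prod>t=1..T. W t)"
    using assms W by (subst ln_le_cancel_iff) (auto intro!: prod_pos mult_pos_pos)
  moreover have "ln (1 / real n * ((1 - \<alpha>) ^ (T' - K) * r ^ K) * exp (- \<eta> * (\<Sum>t=1..T. L (js t) t)))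
    = - ln (real n) + (real (T' - K) * ln (1 - \<alpha>) + ln (r ^ K)) - \<eta> * (\<Sum>t=1..T. L (js t) t)"
  proof -
    have "ln (1 / real n * (x * z) * exp y) = - ln (real n) + (ln x + ln z) + y"
      if "0 < x" "0 < z" for x y z :: real
      using that N by (simp add: ln_mult_pos ln_div)
    from this[of "(1 - \<alpha>) ^ (T' - K)" "r ^ K"] show ?thesis
      using rK \<open>\<alpha> < 1\<close> by (simp add: ln_realpow)
  qed
  moreover have "ln (r ^ K) = real K * (ln \<alpha> - ln (real n))"
    using \<alpha> N by (auto simp: r_def ln_realpow ln_div)
  moreover have "ln (\<Prod>t=1..T. W t) = (\<Sum>t=1..T. ln (W t))"
    by (intro ln_prod) (simp_all add: less_imp_neq[OF W, symmetric])
  moreover have "cross_cost ((real K + 1) * ln (real n)) (real K) (real T - real K - 1) \<alpha>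
    = (real K + 1) * ln (real n) - real K * ln \<alpha> - real (T' - K) * ln (1 - \<alpha>)"
    using \<alpha> assms T' by (auto simp: cross_cost_def ln_div of_nat_diff)
  ultimately have "- (\<Sum>t=1..T. ln (W t)) \<le> \<eta> * (\<Sum>t=1..T. L (js t) t)
      + cross_cost ((real K + 1) * ln (real n)) (real K) (real T - real K - 1) \<alpha>"
    by (simp add: algebra_simps)
  then have "- (\<Sum>t=1..T. ln (W t)) / \<eta> \<le> (\<eta> * (\<Sum>t=1..T. L (js t) t)
      + cross_cost ((real K + 1) * ln (real n)) (real K) (real T - real K - 1) \<alpha>) / \<eta>"
    using \<open>0 < \<eta>\<close> by (intro divide_right_mono) auto
  then show ?thesis
    using \<open>0 < \<eta>\<close> by (simp add: W_def add_divide_distrib sum_negf flip: sum_divide_distrib)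
qed

section \<open>The regret of the aggregate portfolio\<close>

lemma cost_loss_bounds:
  assumes l: "\<And>u v. u \<in> portfolios \<Longrightarrow> v \<in> Y \<Longrightarrow> a \<le> l u v \<and> l u v \<le> b"
    and "p t \<in> portfolios" "p (t - 1) \<in> portfolios" "y t \<in> Y" "0 \<le> c t"
  shows "a \<le> cost_loss l y c p t \<and> cost_loss l y c p t \<le> b + 2 * c t"
proof -
  have "0 \<le> c t * l1_norm (p t - p (t - 1))" "c t * l1_norm (p t - p (t - 1)) \<le> c t * 2"
    using assms l1_norm_portfolio_diff by (auto intro!: mult_left_mono mult_nonneg_nonneg l1_norm_nonneg)
  then show ?thesis
    using l[OF assms(2,4)] unfolding cost_loss_def by linarith
qed

text \<open>
  The aggregate moves because the experts move, seen under the new weights, and because the weights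
  move across the old portfolios, each of which has norm one.
\<close>

lemma aggregate_move_le:
  assumes q: "weight_vector N q"
    and u: "\<And>j. j \<in> N \<Longrightarrow> u j \<in> portfolios"
  shows "l1_norm ((\<Sum>j\<in>N. q j *\<^sub>R v j) - (\<Sum>j\<in>N. r j *\<^sub>R u j))
    \<le> (\<Sum>j\<in>N. q j * l1_norm (v j - u j)) + (\<Sum>j\<in>N. \<bar>q j - r j\<bar>)"
proof -
  have "(\<Sum>j\<in>N. q j *\<^sub>R v j) - (\<Sum>j\<in>N. r j *\<^sub>R u j)
      = (\<Sum>j\<in>N. q j *\<^sub>R (v j - u j)) + (\<Sum>j\<in>N. (q j - r j) *\<^sub>R u j)"
    by (simp add: algebra_simps sum.distrib sum_subtractf)
  also have "l1_norm \<dots> \<le> (\<Sum>j\<in>N. l1_norm (q j *\<^sub>R (v j - u j))) + (\<Sum>j\<in>N. l1_norm ((q j - r j) *\<^sub>R u j))"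
    by (intro order_trans[OF l1_norm_add] add_mono l1_norm_sum)
  also have "(\<Sum>j\<in>N. l1_norm (q j *\<^sub>R (v j - u j))) = (\<Sum>j\<in>N. q j * l1_norm (v j - u j))"
    using q by (intro sum.cong) (auto simp: l1_norm_scaleR weight_vector_def)
  also have "(\<Sum>j\<in>N. l1_norm ((q j - r j) *\<^sub>R u j)) = (\<Sum>j\<in>N. \<bar>q j - r j\<bar>)"
    using u by (intro sum.cong) (auto simp: l1_norm_scaleR l1_norm_portfolio)
  finally show ?thesis .
qed

text \<open>
  In the first round the weights cause no movement: all experts start from \<open>w0\<close>, which is therefore
  its own average under any weights.
\<close>

lemma aggregate_cost_loss_le:
  assumes N: "finite N" "N \<noteq> {}" and q: "\<And>t. 1 \<le> t \<Longrightarrow> weight_vector N (q t)"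
    and l: "convex_on portfolios (\<lambda>u. l u (y t))"
    and w0: "w0 \<in> portfolios" "\<And>j. j \<in> N \<Longrightarrow> w j 0 = w0"
    and w: "\<And>j t. j \<in> N \<Longrightarrow> 1 \<le> t \<Longrightarrow> w j t \<in> portfolios"
    and t: "1 \<le> t" and c: "0 \<le> c t"
  shows "cost_loss l y c (aggregate N w0 w q) t
    \<le> (\<Sum>j\<in>N. q t j * cost_loss l y c (w j) t)
      + (if t = 1 then 0 else c t * (\<Sum>j\<in>N. \<bar>q t j - q (t - 1) j\<bar>))"
proof -
  define drift where "drift = (if t = 1 then 0 else (\<Sum>j\<in>N. \<bar>q t j - q (t - 1) j\<bar>))"
  have w_all: "w j s \<in> portfolios" if "j \<in> N" for j s
    using w[OF that, of s] w0 that by (cases s) auto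
  have qt: "weight_vector N (q t)" using q t by auto
  have "l (\<Sum>j\<in>N. q t j *\<^sub>R w j t) (y t) \<le> (\<Sum>j\<in>N. q t j * l (w j t) (y t))"
    using convex_on_sum[OF N l, of "q t" "\<lambda>j. w j t"] qt w_all by (auto simp: weight_vector_def)
  moreover have "l1_norm (aggregate N w0 w q t - aggregate N w0 w q (t - 1))
      \<le> (\<Sum>j\<in>N. q t j * l1_norm (w j t - w j (t - 1))) + drift"
  proof (cases "t = 1")
    case True
    have "w0 = (\<Sum>j\<in>N. q t j *\<^sub>R w j 0)"
      using qt w0 by (simp add: weight_vector_def flip: scaleR_sum_left)
    then show ?thesis
      using aggregate_move_le[OF qt, of "\<lambda>j. w j 0" "\<lambda>j. w j t" "q t"] w_all True
      by (simp add: aggregate_def drift_def)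
  next
    case False
    then show ?thesis
      using aggregate_move_le[OF qt, of "\<lambda>j. w j (t - 1)" "\<lambda>j. w j t" "q (t - 1)"] w_all t
      by (simp add: aggregate_def drift_def)
  qed
  then have "c t * l1_norm (aggregate N w0 w q t - aggregate N w0 w q (t - 1))
      \<le> c t * ((\<Sum>j\<in>N. q t j * l1_norm (w j t - w j (t - 1))) + drift)"
    using c by (intro mult_left_mono)
  moreover have "(\<Sum>j\<in>N. q t j * cost_loss l y c (w j) t)
      = (\<Sum>j\<in>N. q t j * l (w j t) (y t)) + c t * (\<Sum>j\<in>N. q t j * l1_norm (w j t - w j (t - 1)))"
    by (simp add: cost_loss_def distrib_left sum.distrib sum_distrib_left mult_ac)
  ultimately show ?thesis
    using t by (simp add: cost_loss_def[of _ _ _ "aggregate _ _ _ _"] aggregate_def[of _ _ _ _ t]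
        distrib_left drift_def split: if_splits)
qed

text \<open>
  The parameter-dependent bound: the average loss of the experts is the mix loss plus the Hoeffding
  gap, which contributes the squares in \<open>A_term\<close>; the movement of the weights contributes
  the second sum in \<open>A_term\<close> and the term linear in \<open>\<alpha>\<close>; the summed mix loss
  contributes the complexity.
\<close>

lemma fixed_share_regret_le:
  assumes N: "finite N" "card N = n" "0 < n"
    and conv: "\<And>v. v \<in> Y \<Longrightarrow> convex_on portfolios (\<lambda>u. l u v)"
    and l: "\<And>u v. u \<in> portfolios \<Longrightarrow> v \<in> Y \<Longrightarrow> a \<le> l u v \<and> l u v \<le> b"
    and w0: "w0 \<in> portfolios" "\<And>j. j \<in> N \<Longrightarrow> w j 0 = w0"
    and w: "\<And>j t. j \<in> N \<Longrightarrow> 1 \<le> t \<Longrightarrow> w j t \<in> portfolios"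
    and y: "\<And>t. 1 \<le> t \<Longrightarrow> y t \<in> Y"
    and T: "1 \<le> T" "K < T" and c: "\<And>t. t \<in> {1..T} \<Longrightarrow> 0 \<le> c t"
    and \<eta>: "0 < \<eta>" and \<alpha>: "0 \<le> \<alpha>" "\<alpha> < 1" "0 < \<alpha> \<or> K = 0"
  shows "fixed_share_regret N l y c w0 w \<eta> \<alpha> T K
    \<le> cross_cost ((real K + 1) * ln (real n)) (real K) (real T - real K - 1) \<alpha> / \<eta>
      + \<eta> * A_term a b c T + 2 * \<alpha> * (1 - 1 / real n) * total_cost c T"
proof -
  define L where "L = (\<lambda>j. cost_loss l y c (w j))"
  define q where "q = fixed_share N \<eta> \<alpha> L"
  define D where "D = (\<lambda>t. b - a + 2 * c t)"
  define mix where "mix = (\<lambda>t. - ln (\<Sum>j\<in>N. q t j * exp (- \<eta> * L j t)) / \<eta>)"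
  define B where "B = 2 * \<alpha> * (1 - 1 / real n)"
  have "N \<noteq> {}" using N by auto
  have q: "weight_vector N (q t)" for t
    unfolding q_def using N \<open>N \<noteq> {}\<close> \<alpha> by (intro weight_vector_fixed_share) auto
  have w_all: "w j s \<in> portfolios" if "j \<in> N" for j s
    using w[OF that, of s] w0 that by (cases s) auto
  have L: "a \<le> L j t \<and> L j t \<le> b + 2 * c t" if "j \<in> N" "t \<in> {1..T}" for j t
    unfolding L_def using w_all y c that by (intro cost_loss_bounds[OF l]) auto
  have B: "0 \<le> B" using \<alpha> N by (simp add: B_def)
  have step: "cost_loss l y c (aggregate N w0 w q) t
      \<le> mix t + \<eta> * (D t)\<^sup>2 / 8 + (if t = 1 then 0 else c t * (\<eta> * D (t - 1) + B))"
    if t: "t \<in> {1..T}" for t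
  proof -
    have "cost_loss l y c (aggregate N w0 w q) t \<le> (\<Sum>j\<in>N. q t j * L j t)
        + (if t = 1 then 0 else c t * (\<Sum>j\<in>N. \<bar>q t j - q (t - 1) j\<bar>))"
      unfolding L_def using t y c q
      by (intro aggregate_cost_loss_le N(1) \<open>N \<noteq> {}\<close> conv w0 w) auto
    also have "(\<Sum>j\<in>N. q t j * L j t) \<le> mix t + \<eta> * (b + 2 * c t - a)\<^sup>2 / 8"
      unfolding mix_def using N q \<eta> L t by (intro mix_loss_hoeffding) auto
    also have "b + 2 * c t - a = D t" by (simp add: D_def)
    also have "(if t = 1 then 0 else c t * (\<Sum>j\<in>N. \<bar>q t j - q (t - 1) j\<bar>))
        \<le> (if t = 1 then 0 else c t * (\<eta> * D (t - 1) + B))"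
    proof (cases "t = 1")
      case False
      then obtain s where s: "t = Suc s" "s \<in> {1..T}" "1 \<le> s" using t by (cases t) auto
      have "(\<Sum>j\<in>N. \<bar>q t j - q s j\<bar>) \<le> \<eta> * D s + B"
        unfolding q_def B_def s(1)
      proof (rule fixed_share_drift[OF N])
        fix j k assume "j \<in> N" "k \<in> N"
        then show "\<bar>L j s - L k s\<bar> \<le> D s"
          using L[of j s] L[of k s] s unfolding D_def by auto
      qed (use \<eta> \<alpha> s in auto)
      then show ?thesis using False s c[OF t] by (auto intro!: mult_left_mono)
    qed simp
    finally show ?thesis by simp
  qed
  have main: "(\<Sum>t=1..T. cost_loss l y c (aggregate N w0 w q) t) \<le> (\<Sum>t=1..T. mix t)
      + \<eta> * A_term a b c T + B * total_cost c T"
  proof -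
    have split: "(\<Sum>t=1..T. if t = 1 then 0 else f t) = (\<Sum>t=2..T. f t)" for f :: "nat \<Rightarrow> real"
    proof -
      have "(\<Sum>t=1..T. if t = 1 then 0 else f t) = (\<Sum>t=Suc 1..T. if t = 1 then 0 else f t)"
        using T by (subst sum.atLeast_Suc_atMost) auto
      also have "\<dots> = (\<Sum>t=2..T. f t)"
        by (intro sum.cong) auto
      finally show ?thesis .
    qed
    have "(\<Sum>t=1..T. cost_loss l y c (aggregate N w0 w q) t)
      \<le> (\<Sum>t=1..T. mix t + \<eta> * (D t)\<^sup>2 / 8 + (if t = 1 then 0 else c t * (\<eta> * D (t - 1) + B)))"
      by (intro sum_mono step)
    also have "\<dots> = (\<Sum>t=1..T. mix t) + \<eta> * A_term a b c T + B * (\<Sum>t=2..T. c t)"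
      unfolding sum.distrib split A_term_def D_def
      by (simp add: distrib_left sum.distrib mult_ac flip: sum_divide_distrib sum_distrib_left)
    also have "B * (\<Sum>t=2..T. c t) \<le> B * total_cost c T"
      unfolding total_cost_def using B c by (intro mult_left_mono sum_mono2) auto
    finally show ?thesis by simp
  qed
  have "finite (comparators N T K)"
    unfolding comparators_def using N by (intro finite_subset[OF _ finite_PiE[of "{1..T}" "\<lambda>_. N"]]) auto
  moreover have "comparators N T K \<noteq> {}"
  proof -
    obtain i where "i \<in> N" using \<open>N \<noteq> {}\<close> by auto
    have "switches T (restrict (\<lambda>_. i) {1..T}) = 0"
      unfolding switches_def by auto
    then have "restrict (\<lambda>_. i) {1..T} \<in> comparators N T K"
      using \<open>i \<in> N\<close> by (auto simp: comparators_def)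
    then show ?thesis by auto
  qed
  ultimately have "Min ((\<lambda>js. \<Sum>t=1..T. cost_loss l y c (w (js t)) t) ` comparators N T K)
      \<in> (\<lambda>js. \<Sum>t=1..T. cost_loss l y c (w (js t)) t) ` comparators N T K"
    by (intro Min_in) auto
  then obtain js where js: "js \<in> comparators N T K"
    and Min: "Min ((\<lambda>js. \<Sum>t=1..T. cost_loss l y c (w (js t)) t) ` comparators N T K)
      = (\<Sum>t=1..T. L (js t) t)"
    by (auto simp: L_def)
  have "(\<Sum>t=1..T. mix t) \<le> (\<Sum>t=1..T. L (js t) t)
      + cross_cost ((real K + 1) * ln (real n)) (real K) (real T - real K - 1) \<alpha> / \<eta>"
    unfolding mix_def q_def using N \<eta> \<alpha> T js by (intro fixed_share_mix_loss) auto
  then show ?thesis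
    using main unfolding fixed_share_regret_def tracking_regret_def Min L_def[symmetric]
      q_def[symmetric] B_def by linarith
qed

section \<open>Minimising the bound in the learning rate and the mixing parameter\<close>

lemma complexity_eq_cross_cost:
  assumes "0 < \<alpha> \<or> K = 0"
  shows "complexity K \<alpha> n T
    = ereal (cross_cost ((real K + 1) * ln (real n)) (real K) (real T - real K - 1) \<alpha>)"
  using assms by (auto simp: complexity_def cross_cost_def)

lemma A_term_pos:
  assumes "a < b" "1 \<le> T" "\<And>t. t \<in> {1..T} \<Longrightarrow> 0 \<le> c t"
  shows "0 < A_term a b c T"
proof -
  have "0 < b - a + 2 * c t" if "t \<in> {1..T}" for t using assms(1) assms(3)[OF that] by simp
  then have "0 < (\<Sum>t=1..T. (b - a + 2 * c t)\<^sup>2)"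
    using assms by (intro sum_pos) (auto simp: less_imp_neq[THEN not_sym])
  moreover have "0 \<le> (\<Sum>t=2..T. c t * (b - a + 2 * c (t - 1)))"
  proof (intro sum_nonneg mult_nonneg_nonneg add_nonneg_nonneg)
    fix t assume "t \<in> {2..T}"
    then have "t \<in> {1..T}" "t - 1 \<in> {1..T}" by auto
    then show "0 \<le> c t" "0 \<le> c (t - 1)" by (auto intro: assms(3))
  qed (use assms in auto)
  ultimately show ?thesis unfolding A_term_def by simp
qed

lemma A_term_zero_cost:
  assumes "total_cost c T = 0" "\<And>t. t \<in> {1..T} \<Longrightarrow> 0 \<le> c t"
  shows "A_term a b c T = real T * (b - a)\<^sup>2 / 8"
proof -
  have "c t = 0" if "t \<in> {1..T}" for t
    using assms that sum_nonneg_eq_0_iff[of "{1..T}" c] by (auto simp: total_cost_def)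
  then show ?thesis by (simp add: A_term_def)
qed

text \<open>
  Gibbs' inequality: the cross entropy is smallest at the true parameter. It follows from
  \<open>ln z \<le> z - 1\<close> for the two likelihood ratios, whose linear bounds cancel.
\<close>

lemma gibbs_inequality:
  fixes k m x :: real
  assumes "0 \<le> k" "0 < m" "0 \<le> x" "x < 1" "0 < x \<or> k = 0"
  shows "cross_cost c\<^sub>0 k m (k / (k + m)) \<le> cross_cost c\<^sub>0 k m x"
proof -
  define p where "p = k / (k + m)"
  have p: "1 - p = m / (k + m)" using assms by (simp add: p_def field_simps)
  have "m * ln ((1 - x) / (1 - p)) \<le> m * ((1 - x) / (1 - p) - 1)"
    using assms p by (intro mult_left_mono ln_le_minus_one) auto
  also have "\<dots> = (k + m) * (1 - x) - m"
    using assms unfolding p by (simp add: field_simps)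
  finally have 1: "m * ln ((1 - x) / (1 - p)) \<le> (k + m) * (1 - x) - m" .
  then have 1: "m * ln (1 - x) - m * ln (1 - p) \<le> (k + m) * (1 - x) - m"
  proof -
    have "ln ((1 - x) / (1 - p)) = ln (1 - x) - ln (1 - p)"
    proof -
      have "0 < 1 - x" "0 < 1 - p" using assms p by auto
      then show ?thesis by (rule ln_divide_pos)
    qed
    then show ?thesis using 1 by (simp only: right_diff_distrib)
  qed
  have 2: "k * ln x - k * ln p \<le> (k + m) * x - k"
  proof (cases "k = 0")
    case False
    then have "0 < x" "0 < k" using assms by auto
    have "k * ln (x / p) \<le> k * (x / p - 1)"
      using assms \<open>0 < x\<close> \<open>0 < k\<close> by (intro mult_left_mono ln_le_minus_one) (auto simp: p_def)
    also have "\<dots> = (k + m) * x - k"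
      using \<open>0 < k\<close> \<open>0 < m\<close> by (simp add: p_def field_simps)
    finally have "k * ln (x / p) \<le> (k + m) * x - k" .
    moreover have "ln (x / p) = ln x - ln p"
      using \<open>0 < x\<close> \<open>0 < k\<close> assms by (intro ln_divide_pos) (auto simp: p_def)
    ultimately show ?thesis by (simp only: right_diff_distrib)
  qed (use assms in simp)
  have "ln (1 / z) = - ln z" for z :: real by (simp add: ln_div)
  then have cost: "cross_cost c\<^sub>0 k m z = c\<^sub>0 - k * ln z - m * ln (1 - z)" for z
    by (simp add: cross_cost_def)
  have "(k + m) * (1 - x) - m + ((k + m) * x - k) = 0" by (simp add: algebra_simps)
  then have "cross_cost c\<^sub>0 k m p \<le> cross_cost c\<^sub>0 k m x"
    unfolding cost using 1 2 by linarith
  then show ?thesis by (simp add: p_def)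
qed

lemma cross_cost_ge:
  assumes "0 \<le> k" "0 \<le> m" "0 \<le> x" "x < 1"
  shows "c\<^sub>0 \<le> cross_cost c\<^sub>0 k m x"
proof -
  have "0 \<le> ln (1 / x)" using assms by (cases "x = 0") auto
  moreover have "0 \<le> ln (1 / (1 - x))" using assms by auto
  ultimately show ?thesis using assms by (simp add: cross_cost_def)
qed

lemma cross_cost_entropy:
  assumes "0 \<le> k" "0 < m"
  shows "cross_cost c\<^sub>0 k m (k / (k + m)) = c\<^sub>0 + (k + m) * binary_entropy (k / (k + m))"
proof -
  define p where "p = k / (k + m)"
  have k: "k = (k + m) * p" and m: "m = (k + m) * (1 - p)" using assms by (auto simp: p_def field_simps)
  have p: "0 \<le> p" "p < 1" using assms by (auto simp: p_def)
  have "k * ln (1 / p) = - k * ln p" using p by (cases "p = 0") (auto simp: ln_div)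
  moreover have "m * ln (1 / (1 - p)) = - m * ln (1 - p)" using p by (simp add: ln_div)
  moreover have "k * ln p = (k + m) * (p * ln p)" "m * ln (1 - p) = (k + m) * ((1 - p) * ln (1 - p))"
    by (simp_all only: mult.assoc[symmetric] k[symmetric] m[symmetric])
  moreover have "(k + m) * binary_entropy p = - ((k + m) * (p * ln p)) - (k + m) * ((1 - p) * ln (1 - p))"
    by (simp only: binary_entropy_def right_diff_distrib mult_minus_left mult_minus_right)
  ultimately show ?thesis
    unfolding p_def[symmetric] cross_cost_def by linarith
qed

lemma rate_trade_off:
  fixes A C \<eta> :: real
  assumes "0 < A" "0 < C"
  shows "0 < \<eta> \<Longrightarrow> 2 * sqrt (A * C) \<le> C / \<eta> + \<eta> * A"
    and "C / sqrt (C / A) + sqrt (C / A) * A = 2 * sqrt (A * C)"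
proof -
  show "2 * sqrt (A * C) \<le> C / \<eta> + \<eta> * A" if "0 < \<eta>"
    using arith_geo_mean_sqrt[of "C / \<eta>" "\<eta> * A"] assms that by (simp add: mult.commute)
next
  define \<eta> where "\<eta> = sqrt (C / A)"
  have \<eta>: "0 < \<eta>" using assms by (simp add: \<eta>_def)
  have "\<eta>\<^sup>2 = C / A" using assms by (simp add: \<eta>_def)
  then have C: "C = A * \<eta>\<^sup>2" using assms by (simp add: field_simps)
  have "sqrt (A * C) = sqrt ((A * \<eta>)\<^sup>2)" by (simp add: C power2_eq_square mult_ac)
  then have "sqrt (A * C) = A * \<eta>" using assms \<eta> by simp
  moreover have "C / \<eta> = A * \<eta>" using \<eta> by (simp add: C power2_eq_square)
  ultimately show "C / sqrt (C / A) + sqrt (C / A) * A = 2 * sqrt (A * C)"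
    by (simp add: \<eta>_def[symmetric] mult.commute)
qed

text \<open>
  For a fixed mixing parameter the best rate balances the first two terms of the bound by the
  inequality of arithmetic and geometric means, so that only a function of the mixing parameter
  remains to be minimised. Values with infinite complexity cannot compete.
\<close>

lemma optimal_parametersI:
  fixes a b :: real and c :: "nat \<Rightarrow> real" and n T K :: nat
  defines "C \<equiv> cross_cost ((real K + 1) * ln (real n)) (real K) (real T - real K - 1)"
    and "B \<equiv> 2 * (1 - 1 / real n) * total_cost c T"
  assumes A: "0 < A_term a b c T" and "2 \<le> n" "K < T" and \<alpha>: "0 \<le> \<alpha>" "\<alpha> < 1" "0 < \<alpha> \<or> K = 0"
    and min: "\<And>x. 0 \<le> x \<Longrightarrow> x < 1 \<Longrightarrow> 0 < x \<or> K = 0 \<Longrightarrow>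
      2 * sqrt (A_term a b c T * C \<alpha>) + B * \<alpha> \<le> 2 * sqrt (A_term a b c T * C x) + B * x"
  shows "optimal_parameters a b c n T K (sqrt (C \<alpha> / A_term a b c T)) \<alpha>"
proof -
  have C: "0 < C x" if "0 \<le> x" "x < 1" for x
  proof -
    have "(real K + 1) * ln (real n) \<le> C x"
      unfolding C_def using that \<open>K < T\<close> by (intro cross_cost_ge) auto
    moreover have "0 < (real K + 1) * ln (real n)" using \<open>2 \<le> n\<close> by (intro mult_pos_pos) auto
    ultimately show ?thesis by simp
  qed
  have U: "upper_bound a b c n T K \<eta> x = ereal (C x / \<eta> + \<eta> * A_term a b c T + B * x)"
    if "0 < x \<or> K = 0" "0 < \<eta>" for \<eta> x
    using that by (simp add: upper_bound_def complexity_eq_cross_cost C_def B_def mult_ac)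
  have opt: "upper_bound a b c n T K (sqrt (C \<alpha> / A_term a b c T)) \<alpha>
      = ereal (2 * sqrt (A_term a b c T * C \<alpha>) + B * \<alpha>)"
    using rate_trade_off(2)[OF A C[OF \<alpha>(1,2)]] A C[OF \<alpha>(1,2)] by (simp add: U[OF \<alpha>(3)])
  have "upper_bound a b c n T K (sqrt (C \<alpha> / A_term a b c T)) \<alpha> \<le> upper_bound a b c n T K \<eta> x"
    if "0 < \<eta>" "0 \<le> x" "x < 1" for \<eta> x
  proof (cases "0 < x \<or> K = 0")
    case True
    have "2 * sqrt (A_term a b c T * C x) + B * x \<le> C x / \<eta> + \<eta> * A_term a b c T + B * x"
      using rate_trade_off(1)[OF A C that(1)] that by simp
    then show ?thesis
      using min[OF that(2,3) True] unfolding opt U[OF True that(1)] by simp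
  next
    case False
    then have "complexity K x n T / ereal \<eta> = \<infinity>"
      using that by (simp add: complexity_def)
    then show ?thesis by (simp add: upper_bound_def)
  qed
  then show ?thesis
    unfolding optimal_parameters_def is_arg_min_def
    using \<alpha>(1,2) A C[OF \<alpha>(1,2)] by (auto simp: not_less[symmetric])
qed

section \<open>The stationary mixing parameter\<close>

text \<open>
  Minus twice the derivative of the square root of \<open>cross_cost\<close>. The equation that defines the mixing
  parameter says that \<open>2 * sqrt (A * cross_cost c\<^sub>0 k m x) + B * x\<close> is stationary, that is
  \<open>sqrt A * cross_slope c\<^sub>0 k m x = B\<close>.
\<close>

definition cross_slope :: "real \<Rightarrow> real \<Rightarrow> real \<Rightarrow> real \<Rightarrow> real" where
  "cross_slope c\<^sub>0 k m x = (k / x - m / (1 - x)) / sqrt (cross_cost c\<^sub>0 k m x)"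

lemma cross_cost_deriv:
  assumes "0 < x" "x < 1"
  shows "(cross_cost c\<^sub>0 k m has_real_derivative - (k / x - m / (1 - x))) (at x)"
proof -
  have "((\<lambda>x. c\<^sub>0 - k * ln x - m * ln (1 - x)) has_real_derivative - (k / x - m / (1 - x))) (at x)"
    using assms by (auto intro!: derivative_eq_intros)
  moreover have "\<forall>\<^sub>F y in nhds x. cross_cost c\<^sub>0 k m y = c\<^sub>0 - k * ln y - m * ln (1 - y)"
    using assms
    by (intro eventually_nhds_in_open[of "{0<..<1}", THEN eventually_mono])
      (auto simp: cross_cost_def ln_div)
  ultimately show ?thesis by (subst DERIV_cong_ev[OF refl _ refl])
qed

lemma cross_slope_deriv:
  assumes "0 < c\<^sub>0" "0 < k" "0 < m" "0 < x" "x < 1"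
  shows "(cross_slope c\<^sub>0 k m has_real_derivative
    ((k / x - m / (1 - x))\<^sup>2 / (2 * cross_cost c\<^sub>0 k m x) - (k / x\<^sup>2 + m / (1 - x)\<^sup>2))
      / sqrt (cross_cost c\<^sub>0 k m x)) (at x)"
proof -
  define C where "C = cross_cost c\<^sub>0 k m x"
  have C: "0 < C" using cross_cost_ge[of k m x c\<^sub>0] assms by (simp add: C_def)
  have F: "((\<lambda>x. k / x - m / (1 - x)) has_real_derivative - (k / x\<^sup>2 + m / (1 - x)\<^sup>2)) (at x)"
    using assms by (auto intro!: derivative_eq_intros simp: power2_eq_square)
  have S: "((\<lambda>x. sqrt (cross_cost c\<^sub>0 k m x)) has_real_derivative
      - (k / x - m / (1 - x)) * (inverse (sqrt C) / 2)) (at x)"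
    using DERIV_chain2[OF DERIV_real_sqrt[OF C, unfolded C_def] cross_cost_deriv[of x c\<^sub>0 k m]] assms
    by (simp add: C_def mult_ac)
  have eq: "(- u * sqrt C - f * (- f * (inverse (sqrt C) / 2))) / (sqrt C * sqrt C)
      = (f\<^sup>2 / (2 * C) - u) / sqrt C" for u f :: real
    using C by (simp add: field_simps power2_eq_square)
  show ?thesis
    unfolding cross_slope_def
    using DERIV_divide[OF F S] C eq[of "k / x\<^sup>2 + m / (1 - x)\<^sup>2" "k / x - m / (1 - x)"]
    by (simp add: C_def)
qed

text \<open>
  The square root of a convex function \<open>C\<close> is strictly convex where \<open>C'\<^sup>2 < 2 * C * C''\<close>. Left of the
  minimiser \<open>k / (k + m)\<close> the square of \<open>C'\<close> is at most \<open>(k / x)\<^sup>2\<close>, whereas \<open>C'' \<ge> k / x\<^sup>2\<close>, so that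
  \<open>k < 2 * C\<close> suffices; the constant \<open>c\<^sub>0\<close> guarantees this.
\<close>

lemma cross_slope_strict_decreasing:
  assumes "0 < k" "0 < m" "k < 2 * c\<^sub>0" and xy: "0 < x" "x < y" "y \<le> k / (k + m)"
  shows "cross_slope c\<^sub>0 k m y < cross_slope c\<^sub>0 k m x"
proof (rule DERIV_neg_imp_decreasing[OF xy(2)])
  fix z assume z: "x \<le> z" "z \<le> y"
  have "k / (k + m) < 1" using assms by simp
  then have z01: "0 < z" "z < 1" using z xy by auto
  have "z \<le> k / (k + m)" using z xy by simp
  then have "z * (k + m) \<le> k" using assms(1,2) by (simp add: pos_le_divide_eq)
  then have F0: "0 \<le> k / z - m / (1 - z)" using z01 by (simp add: field_simps)
  moreover have "k / z - m / (1 - z) \<le> k / z" using assms z01 by simp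
  ultimately have F: "(k / z - m / (1 - z))\<^sup>2 \<le> (k / z)\<^sup>2" by (rule power_mono[rotated])
  have C: "k < 2 * cross_cost c\<^sub>0 k m z" using cross_cost_ge[of k m z c\<^sub>0] assms z01 by simp
  have "(k / z - m / (1 - z))\<^sup>2 / (2 * cross_cost c\<^sub>0 k m z) \<le> (k / z)\<^sup>2 / (2 * cross_cost c\<^sub>0 k m z)"
    using F C assms by (intro divide_right_mono) auto
  also have "\<dots> < (k / z)\<^sup>2 / k"
    using C assms z01 by (intro divide_strict_left_mono) auto
  also have "\<dots> = k / z\<^sup>2" using assms by (simp add: power2_eq_square)
  also have "\<dots> \<le> k / z\<^sup>2 + m / (1 - z)\<^sup>2" using assms by simp
  finally have "((k / z - m / (1 - z))\<^sup>2 / (2 * cross_cost c\<^sub>0 k m z) - (k / z\<^sup>2 + m / (1 - z)\<^sup>2))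
      / sqrt (cross_cost c\<^sub>0 k m z) < 0"
    using C assms by (intro divide_neg_pos) auto
  then show "\<exists>d. (cross_slope c\<^sub>0 k m has_real_derivative d) (at z) \<and> d < 0"
    using cross_slope_deriv[of c\<^sub>0 k m z] assms z01 by fastforce
qed

lemma cross_slope_at_top:
  assumes "0 < c\<^sub>0" "0 < k" "0 < m"
  shows "filterlim (cross_slope c\<^sub>0 k m) at_top (at_right 0)"
  unfolding cross_slope_def cross_cost_def using assms by real_asymp

lemma cross_slope_solution:
  assumes "0 < k" "0 < m" "k < 2 * c\<^sub>0" "0 < v"
  shows "\<exists>!x. x \<in> {0<..<k / (k + m)} \<and> cross_slope c\<^sub>0 k m x = v"
proof -
  define p where "p = k / (k + m)"
  have p: "0 < p" "p < 1" using assms by (auto simp: p_def)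
  have c0: "0 < c\<^sub>0" using assms by simp
  have "\<forall>\<^sub>F x in at_right 0. v \<le> cross_slope c\<^sub>0 k m x \<and> x \<in> {0<..<p}"
    using cross_slope_at_top[OF c0 assms(1,2)] p
    by (intro eventually_conj eventually_at_right_real) (auto simp: filterlim_at_top)
  then obtain x\<^sub>0 where x0: "v \<le> cross_slope c\<^sub>0 k m x\<^sub>0" "0 < x\<^sub>0" "x\<^sub>0 < p"
    by (auto dest: eventually_happens)
  have zero: "cross_slope c\<^sub>0 k m p = 0"
  proof -
    have "k / p = k + m" "1 - p = m / (k + m)" using assms by (simp_all add: p_def field_simps)
    then show ?thesis using assms by (simp add: cross_slope_def)
  qed
  have "\<exists>x\<ge>x\<^sub>0. x \<le> p \<and> cross_slope c\<^sub>0 k m x = v"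
  proof (rule IVT2')
    show "continuous_on {x\<^sub>0..p} (cross_slope c\<^sub>0 k m)"
      using x0 p assms c0
      by (intro continuous_at_imp_continuous_on ballI DERIV_isCont[OF cross_slope_deriv]) auto
  qed (use zero assms x0 in auto)
  then obtain x where x: "x\<^sub>0 \<le> x" "x \<le> p" "cross_slope c\<^sub>0 k m x = v" by auto
  then have "x \<noteq> p" using zero assms by auto
  show ?thesis
  proof (rule ex1I[of _ x])
    show "x \<in> {0<..<k / (k + m)} \<and> cross_slope c\<^sub>0 k m x = v"
      using x \<open>x \<noteq> p\<close> x0 by (auto simp: p_def)
    fix x' assume "x' \<in> {0<..<k / (k + m)} \<and> cross_slope c\<^sub>0 k m x' = v"
    then show "x' = x"
      using cross_slope_strict_decreasing[OF assms(1-3), of x x']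
        cross_slope_strict_decreasing[OF assms(1-3), of x' x] x x0
      by (cases x x' rule: linorder_cases) (auto simp: p_def)
  qed
qed

text \<open>
  Left of \<open>k / (k + m)\<close> the objective is convex, hence minimal at its stationary point; right of it both
  the cross entropy and the linear term are at least their values at \<open>k / (k + m)\<close>. The square root of
  the cross entropy need not be convex on that side.
\<close>

lemma cross_slope_solution_minimal:
  assumes "0 < k" "0 < m" "k < 2 * c\<^sub>0" "0 < A" "0 \<le> B"
    and x: "0 < x" "x < k / (k + m)" "sqrt A * cross_slope c\<^sub>0 k m x = B"
    and y: "0 < y" "y < 1"
  shows "2 * sqrt (A * cross_cost c\<^sub>0 k m x) + B * x \<le> 2 * sqrt (A * cross_cost c\<^sub>0 k m y) + B * y"
proof -
  define p where "p = k / (k + m)"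
  define g where "g = (\<lambda>z. 2 * sqrt (A * cross_cost c\<^sub>0 k m z) + B * z)"
  have p: "p < 1" "x < p" using assms by (auto simp: p_def)
  have c0: "0 < c\<^sub>0" using assms by simp
  have g: "(g has_real_derivative B - sqrt A * cross_slope c\<^sub>0 k m z) (at z)" if "0 < z" "z < 1" for z
  proof -
    define C where "C = cross_cost c\<^sub>0 k m z"
    have C: "0 < C" using cross_cost_ge[of k m z c\<^sub>0] assms that by (simp add: C_def)
    have S: "((\<lambda>x. sqrt (cross_cost c\<^sub>0 k m x)) has_real_derivative
        - (k / z - m / (1 - z)) * (inverse (sqrt C) / 2)) (at z)"
      using DERIV_chain2[OF DERIV_real_sqrt[OF C, unfolded C_def] cross_cost_deriv[of z c\<^sub>0 k m]] that
      by (simp add: C_def mult_ac)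
    show ?thesis
    proof -
      have eq: "2 * (s * (- f * (i / 2))) + B * 1 = B - s * (f * i)" for s f i :: real by simp
      have "(g has_real_derivative
          2 * (sqrt A * (- (k / z - m / (1 - z)) * (inverse (sqrt C) / 2))) + B * 1) (at z)"
        unfolding g_def real_sqrt_mult by (intro DERIV_add DERIV_cmult S DERIV_ident)
      also have "2 * (sqrt A * (- (k / z - m / (1 - z)) * (inverse (sqrt C) / 2))) + B * 1
          = B - sqrt A * cross_slope c\<^sub>0 k m z"
        by (simp only: eq cross_slope_def C_def divide_inverse[of _ "sqrt _"])
      finally show ?thesis .
    qed
  qed
  have le_p: "g x \<le> g z" if z: "0 < z" "z \<le> p" for z
  proof (cases "z \<le> x")
    case True
    show ?thesis
    proof (rule DERIV_nonpos_imp_nonincreasing[OF True])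
      fix w assume w: "z \<le> w" "w \<le> x"
      have "cross_slope c\<^sub>0 k m x \<le> cross_slope c\<^sub>0 k m w"
        using cross_slope_strict_decreasing[OF assms(1-3), of w x] w z p by (cases "w = x") (auto simp: p_def)
      then have "B \<le> sqrt A * cross_slope c\<^sub>0 k m w"
        using x(3) \<open>0 < A\<close> by (metis mult_left_mono real_sqrt_ge_zero less_imp_le)
      then show "\<exists>d. (g has_real_derivative d) (at w) \<and> d \<le> 0"
        using g[of w] w z p by (intro exI conjI) auto
    qed
  next
    case False
    then have "x \<le> z" by simp
    then show ?thesis
    proof (rule DERIV_nonneg_imp_nondecreasing)
      fix w assume w: "x \<le> w" "w \<le> z"
      have "cross_slope c\<^sub>0 k m w \<le> cross_slope c\<^sub>0 k m x"
        using cross_slope_strict_decreasing[OF assms(1-3), of x w] w z p x(1)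
        by (cases "w = x") (auto simp: p_def)
      then have "sqrt A * cross_slope c\<^sub>0 k m w \<le> B"
        using x(3) \<open>0 < A\<close> by (metis mult_left_mono real_sqrt_ge_zero less_imp_le)
      then show "\<exists>d. (g has_real_derivative d) (at w) \<and> 0 \<le> d"
        using g[of w] w z p x(1) by (intro exI conjI) auto
    qed
  qed
  have "g x \<le> g y"
  proof (cases "y \<le> p")
    case False
    have "cross_cost c\<^sub>0 k m p \<le> cross_cost c\<^sub>0 k m y"
      unfolding p_def using assms by (intro gibbs_inequality) auto
    then have "g p \<le> g y"
      unfolding g_def using assms False by (intro add_mono mult_left_mono real_sqrt_le_mono) auto
    then show ?thesis using le_p[of p] p x(1) by simp
  qed (use le_p y in auto)
  then show ?thesis by (simp add: g_def)
qed

section \<open>Tuned cost-sensitive tracking regret\<close>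

theorem proposition3p5:
  fixes l :: "real^'m \<Rightarrow> real^'m \<Rightarrow> real"
    and Y :: "(real^'m) set"
    and a b :: real
    and N :: "'e set"
    and n T K :: nat
    and w0 :: "real^'m"
    and w :: "'e \<Rightarrow> nat \<Rightarrow> real^'m"
    and y :: "nat \<Rightarrow> real^'m"
    and c :: "nat \<Rightarrow> real"
  assumes "CARD('m) \<ge> 2"
    and "finite N" and "card N = n" and "n \<ge> 2"
    and "a < b"
    and "\<And>v. v \<in> Y \<Longrightarrow> convex_on portfolios (\<lambda>u. l u v)"
    and "\<And>u v. u \<in> portfolios \<Longrightarrow> v \<in> Y \<Longrightarrow> a \<le> l u v \<and> l u v \<le> b"
    and "w0 \<in> portfolios"
    and "\<And>j. j \<in> N \<Longrightarrow> w j 0 = w0"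
    and "\<And>j t. j \<in> N \<Longrightarrow> t \<ge> 1 \<Longrightarrow> w j t \<in> portfolios"
    and "\<And>t. t \<ge> 1 \<Longrightarrow> y t \<in> Y"
    and "T \<ge> 2" and "K \<in> {0..T - 2}"
    and "\<And>t. t \<in> {1..T} \<Longrightarrow> c t \<ge> 0"
  shows
    "(total_cost c T = 0 \<longrightarrow>
       (let E = (real K + 1) * ln (real n) + (real T - 1) * binary_entropy (real K / (real T - 1));
            \<alpha> = real K / (real T - 1);
            \<eta> = 1 / (b - a) * sqrt (8 / real T * E)
        in \<alpha> \<in> {0..<1}
           \<and> optimal_parameters a b c n T K \<eta> \<alpha>
           \<and> fixed_share_regret N l y c w0 w \<eta> \<alpha> T K \<le> (b - a) * sqrt (real T / 2 * E)))
     \<and>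
     (total_cost c T > 0 \<and> K = 0 \<longrightarrow>
       (let \<alpha> = 0;
            \<eta> = sqrt (ln (real n) / A_term a b c T)
        in optimal_parameters a b c n T K \<eta> \<alpha>
           \<and> fixed_share_regret N l y c w0 w \<eta> \<alpha> T 0 \<le> 2 * sqrt (A_term a b c T * ln (real n))))
     \<and>
     (total_cost c T > 0 \<and> K \<ge> 1 \<longrightarrow>
       (\<exists>!\<alpha>. \<alpha> \<in> {0<..<real K / (real T - 1)} \<and> alpha_equation a b c n T K \<alpha>)
       \<and> (\<forall>\<alpha>. \<alpha> \<in> {0<..<real K / (real T - 1)} \<and> alpha_equation a b c n T K \<alpha> \<longrightarrow>
            (let C = real_of_ereal (complexity K \<alpha> n T);
                 \<eta> = sqrt (C / A_term a b c T)
             in optimal_parameters a b c n T K \<eta> \<alpha>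
                \<and> fixed_share_regret N l y c w0 w \<eta> \<alpha> T K
                    \<le> 2 * sqrt (A_term a b c T * C)
                        + 2 * (1 - 1 / real n) * \<alpha> * total_cost c T)))"
proof -
  define A where "A = A_term a b c T"
  define B where "B = 2 * (1 - 1 / real n) * total_cost c T"
  define c\<^sub>0 where "c\<^sub>0 = (real K + 1) * ln (real n)"
  define m where "m = real T - real K - 1"
  define C where "C = cross_cost c\<^sub>0 (real K) m"
  have KT: "K < T" and m: "0 < m" "real K + m = real T - 1"
    using assms(12,13) by (auto simp: m_def)
  have A: "0 < A" unfolding A_def using assms(5,12,14) by (intro A_term_pos) auto
  have c0: "0 < c\<^sub>0" unfolding c\<^sub>0_def using assms(4) by (intro mult_pos_pos) auto
  have C: "0 < C x" if "0 \<le> x" "x < 1" for x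
    using cross_cost_ge[of "real K" m x c\<^sub>0] that c0 m(1) by (simp add: C_def)
  have complexity: "complexity K x n T = ereal (C x)" if "0 < x \<or> K = 0" for x
    using complexity_eq_cross_cost[OF that] by (simp add: C_def c\<^sub>0_def m_def)
  have n: "0 < 1 - 1 / real n" using assms(4) by simp
  have tuned: "optimal_parameters a b c n T K (sqrt (C \<alpha> / A)) \<alpha>
      \<and> fixed_share_regret N l y c w0 w (sqrt (C \<alpha> / A)) \<alpha> T K \<le> 2 * sqrt (A * C \<alpha>) + B * \<alpha>"
    if \<alpha>: "0 \<le> \<alpha>" "\<alpha> < 1" "0 < \<alpha> \<or> K = 0"
      and min: "\<And>x. 0 \<le> x \<Longrightarrow> x < 1 \<Longrightarrow> 0 < x \<or> K = 0 \<Longrightarrow>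
        2 * sqrt (A * C \<alpha>) + B * \<alpha> \<le> 2 * sqrt (A * C x) + B * x" for \<alpha>
  proof
    show "optimal_parameters a b c n T K (sqrt (C \<alpha> / A)) \<alpha>"
      using assms(4) KT \<alpha> A min unfolding A_def B_def C_def c\<^sub>0_def m_def
      by (intro optimal_parametersI) auto
    have \<eta>: "0 < sqrt (C \<alpha> / A)" using A C[OF \<alpha>(1,2)] by simp
    have "fixed_share_regret N l y c w0 w (sqrt (C \<alpha> / A)) \<alpha> T K
        \<le> C \<alpha> / sqrt (C \<alpha> / A) + sqrt (C \<alpha> / A) * A + 2 * \<alpha> * (1 - 1 / real n) * total_cost c T"
      using fixed_share_regret_le[of N n Y l a b w0 w y T K c, OF assms(2,3) _ assms(6,7,8,9,10,11)
          _ KT assms(14) \<eta> \<alpha>] assms(4,12)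
      by (simp add: A_def C_def c\<^sub>0_def m_def)
    then show "fixed_share_regret N l y c w0 w (sqrt (C \<alpha> / A)) \<alpha> T K \<le> 2 * sqrt (A * C \<alpha>) + B * \<alpha>"
      unfolding rate_trade_off(2)[OF A C[OF \<alpha>(1,2)]] by (simp add: B_def mult_ac)
  qed

  show ?thesis
  proof (intro conjI impI)
    assume zero: "total_cost c T = 0"
    define E where "E = (real K + 1) * ln (real n) + (real T - 1) * binary_entropy (real K / (real T - 1))"
    define \<alpha> where "\<alpha> = real K / (real T - 1)"
    have \<alpha>: "0 \<le> \<alpha>" "\<alpha> < 1" "0 < \<alpha> \<or> K = 0" using m by (auto simp: \<alpha>_def simp flip: m(2))
    have E: "E = C \<alpha>"
      using cross_cost_entropy[of "real K" m c\<^sub>0] m by (simp add: C_def E_def c\<^sub>0_def \<alpha>_def)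
    have A': "A = real T * (b - a)\<^sup>2 / 8"
      unfolding A_def using zero assms(14) by (intro A_term_zero_cost) auto
    have sqrt_div: "1 / x * sqrt z = sqrt (z / x\<^sup>2)" if "0 \<le> x" for x z :: real
      using that by (simp add: real_sqrt_divide)
    have "1 / (b - a) * sqrt (8 / real T * E) = sqrt (8 / real T * E / (b - a)\<^sup>2)"
      using assms(5) by (intro sqrt_div) simp
    also have "8 / real T * E / (b - a)\<^sup>2 = C \<alpha> / A"
      using assms(12) by (simp add: A' E)
    finally have \<eta>: "1 / (b - a) * sqrt (8 / real T * E) = sqrt (C \<alpha> / A)" .
    have sqrt_in: "x * sqrt z = sqrt (x\<^sup>2 * z)" if "0 \<le> x" for x z :: real
      using that by (simp add: real_sqrt_mult)
    have "(b - a) * sqrt (real T / 2 * E) = sqrt ((b - a)\<^sup>2 * (real T / 2 * E))"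
      using assms(5) by (intro sqrt_in) simp
    also have "(b - a)\<^sup>2 * (real T / 2 * E) = 2\<^sup>2 * (A * C \<alpha>)" by (simp add: A' E)
    also have "sqrt \<dots> = 2 * sqrt (A * C \<alpha>)" by (simp only: real_sqrt_mult) simp
    finally have bound: "(b - a) * sqrt (real T / 2 * E) = 2 * sqrt (A * C \<alpha>)" .
    have "C \<alpha> \<le> C x" if "0 \<le> x" "x < 1" "0 < x \<or> K = 0" for x
      unfolding C_def \<alpha>_def m(2)[symmetric] using that m(1) by (intro gibbs_inequality) auto
    then have "optimal_parameters a b c n T K (sqrt (C \<alpha> / A)) \<alpha>
      \<and> fixed_share_regret N l y c w0 w (sqrt (C \<alpha> / A)) \<alpha> T K \<le> 2 * sqrt (A * C \<alpha>) + B * \<alpha>"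
      using \<alpha> A zero by (intro tuned) (auto simp: B_def)
    then show "let E = (real K + 1) * ln (real n) + (real T - 1) * binary_entropy (real K / (real T - 1));
            \<alpha> = real K / (real T - 1);
            \<eta> = 1 / (b - a) * sqrt (8 / real T * E)
        in \<alpha> \<in> {0..<1}
           \<and> optimal_parameters a b c n T K \<eta> \<alpha>
           \<and> fixed_share_regret N l y c w0 w \<eta> \<alpha> T K \<le> (b - a) * sqrt (real T / 2 * E)"
      unfolding Let_def E_def[symmetric] unfolding \<alpha>_def[symmetric] \<eta> bound
      using \<alpha> zero by (simp add: B_def)
  next
    assume *: "0 < total_cost c T \<and> K = 0"
    have C0: "C 0 = ln (real n)" using * by (simp add: C_def cross_cost_def c\<^sub>0_def)
    have B: "0 \<le> B" using * n by (simp add: B_def)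
    have "2 * sqrt (A * C 0) + B * 0 \<le> 2 * sqrt (A * C x) + B * x" if "0 \<le> x" "x < 1" for x
    proof -
      have "C 0 \<le> C x"
        using gibbs_inequality[of 0 m x c\<^sub>0] that m(1) * by (simp add: C_def)
      then show ?thesis using A B that by (intro add_mono mult_left_mono) auto
    qed
    then have "optimal_parameters a b c n T K (sqrt (C 0 / A)) 0
      \<and> fixed_share_regret N l y c w0 w (sqrt (C 0 / A)) 0 T K \<le> 2 * sqrt (A * C 0) + B * 0"
      using * by (intro tuned) auto
    then show "let \<alpha> = 0; \<eta> = sqrt (ln (real n) / A_term a b c T)
        in optimal_parameters a b c n T K \<eta> \<alpha>
           \<and> fixed_share_regret N l y c w0 w \<eta> \<alpha> T 0 \<le> 2 * sqrt (A_term a b c T * ln (real n))"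
      using * by (simp add: C0 A_def)
  next
    assume *: "0 < total_cost c T \<and> 1 \<le> K"
    have B: "0 < B" using * n by (simp add: B_def)
    have K: "0 < real K" using * by simp
    have p: "real K / (real T - 1) < 1" using m(1) by (simp flip: m(2))
    have "ln 2 \<le> ln (real n)" using assms(4) by simp
    \<comment> \<open>Two experts are enough for \<open>1 < 2 * ln n\<close>, which makes the slope of the square root monotone.\<close>
    then have "2 / 3 \<le> ln (real n)" using ln2_ge_two_thirds by simp
    then have "(real K + 1) * (2 / 3) \<le> c\<^sub>0" unfolding c\<^sub>0_def by (intro mult_left_mono) auto
    then have Kc0: "real K < 2 * c\<^sub>0" by simp
    have equation: "alpha_equation a b c n T K x \<longleftrightarrow> cross_slope c\<^sub>0 (real K) m x = B / sqrt A"
      if x: "0 < x" "x < 1" for x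
    proof -
      have "(real K - (real T - 1) * x) / (x * (1 - x)) = real K / x - m / (1 - x)"
        using x by (simp add: field_simps flip: m(2))
      then have "alpha_equation a b c n T K x \<longleftrightarrow> real K / x - m / (1 - x) = B * sqrt (C x / A)"
        using x by (simp add: alpha_equation_def complexity B_def A_def)
      also have "\<dots> \<longleftrightarrow> (real K / x - m / (1 - x)) / sqrt (C x) = B / sqrt A"
        using C[of x] x A by (simp add: real_sqrt_divide divide_eq_eq)
      finally show ?thesis by (simp add: cross_slope_def C_def)
    qed
    have "\<exists>!x. x \<in> {0<..<real K / (real T - 1)} \<and> cross_slope c\<^sub>0 (real K) m x = B / sqrt A"
      using cross_slope_solution[OF K m(1) Kc0, of "B / sqrt A"] A B by (simp add: m(2))
    moreover have "x \<in> {0<..<real K / (real T - 1)} \<and> cross_slope c\<^sub>0 (real K) m x = B / sqrt A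
        \<longleftrightarrow> x \<in> {0<..<real K / (real T - 1)} \<and> alpha_equation a b c n T K x" for x
      using equation[of x] p by auto
    ultimately show "\<exists>!\<alpha>. \<alpha> \<in> {0<..<real K / (real T - 1)} \<and> alpha_equation a b c n T K \<alpha>"
      by simp
    show "\<forall>\<alpha>. \<alpha> \<in> {0<..<real K / (real T - 1)} \<and> alpha_equation a b c n T K \<alpha> \<longrightarrow>
            (let C = real_of_ereal (complexity K \<alpha> n T);
                 \<eta> = sqrt (C / A_term a b c T)
             in optimal_parameters a b c n T K \<eta> \<alpha>
                \<and> fixed_share_regret N l y c w0 w \<eta> \<alpha> T K
                    \<le> 2 * sqrt (A_term a b c T * C)
                        + 2 * (1 - 1 / real n) * \<alpha> * total_cost c T)"
    proof (intro allI impI)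
      fix \<alpha> assume "\<alpha> \<in> {0<..<real K / (real T - 1)} \<and> alpha_equation a b c n T K \<alpha>"
      then have \<alpha>: "0 < \<alpha>" "\<alpha> < real K / (real K + m)" "alpha_equation a b c n T K \<alpha>"
        by (auto simp: m(2))
      have \<alpha>1: "\<alpha> < 1" using \<alpha>(2) p m(2) by simp
      have "sqrt A * cross_slope c\<^sub>0 (real K) m \<alpha> = B"
        using equation[of \<alpha>] \<alpha> \<alpha>1 A by simp
      then have "optimal_parameters a b c n T K (sqrt (C \<alpha> / A)) \<alpha>
        \<and> fixed_share_regret N l y c w0 w (sqrt (C \<alpha> / A)) \<alpha> T K \<le> 2 * sqrt (A * C \<alpha>) + B * \<alpha>"
        using \<alpha> \<alpha>1 K B unfolding C_def
        by (intro tuned[unfolded C_def] cross_slope_solution_minimal[OF K m(1) Kc0 A]) auto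
      then show "let C = real_of_ereal (complexity K \<alpha> n T);
                 \<eta> = sqrt (C / A_term a b c T)
             in optimal_parameters a b c n T K \<eta> \<alpha>
                \<and> fixed_share_regret N l y c w0 w \<eta> \<alpha> T K
                    \<le> 2 * sqrt (A_term a b c T * C)
                        + 2 * (1 - 1 / real n) * \<alpha> * total_cost c T"
        using \<alpha>(1) by (simp add: complexity A_def B_def mult_ac)
    qed
  qed
qed

end
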